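(* Let $\mathcal{D}=(\Omega,\mathcal{B})$ be a supersimple $2$-$(n,4,\lambda)$ design satisfying property $(\triangle)$, such that $(\Omega,\mathcal{C})$ is a regular two-graph where $\mathcal{C}$ is the set of collinear triples, and suppose $n>2\lambda+2$. Let $\infty\in\Omega$ and $G:=\mathcal{L}_\infty(\mathcal{D})$, and suppose $G$ contains a non-trivial solvable normal subgroup. Then for some $m\ge2$, $G\cong2^{2m}.\operatorname{Sp}_{2m}(2)$, $n=2^{2m}$, and the stabilizer in $G$ of a point of $\Omega$ is isomorphic to $\operatorname{Sp}_{2m}(2)$.
   Context: A $2$-$(n,4,\lambda)$ design $(\Omega,\mathcal{B})$: $n$ points, a multiset of $4$-subsets (lines), every $2$-subset in exactly $\lambda$ lines; supersimple: distinct lines meet in at most two points. For distinct $a,b$ with lines $\{a,b,a_i,b_i\}$ through them, $[a,b]:=(a,b)\prod_i(a_i,b_i)$; $[a,a]:=1$. Permutations act on the right, products composed left to right; $[a_0,\dots,a_k]:=[a_0,a_1]\cdots[a_{k-1},a_k]$; $\mathcal{L}_\infty(\mathcal{D})$ = move sequences starting at $\infty$ (a group under these hypotheses). Property $(\triangle)$: if $B_1,B_2\in\mathcal{B}$ with $|B_1\cap B_2|=2$ then $B_1\triangle B_2\in\mathcal{B}$. Regular two-graph: $(\Omega,\mathcal{C})$ is a $2$-$(n,3,\mu)$ design with every $4$-subset containing $0,2$ or $4$ members of $\mathcal{C}$. $2^{2m}.\operatorname{Sp}_{2m}(2)$ denotes a group with an elementary abelian normal subgroup of order $2^{2m}$ and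 quotient isomorphic to $\operatorname{Sp}_{2m}(2)$. *)

theory Defs
  imports "HOL-Algebra.Algebra" "HOL-Combinatorics.Transposition" "HOL-Library.Multiset"
begin

definition design_2_4 :: "'a set \<Rightarrow> 'a set multiset \<Rightarrow> nat \<Rightarrow> nat \<Rightarrow> bool" where
  "design_2_4 \<Omega> B n lam \<longleftrightarrow> finite \<Omega> \<and> card \<Omega> = n \<and> lam \<ge> 1 \<and>
     (\<forall>L \<in># B. L \<subseteq> \<Omega> \<and> card L = 4) \<and>
     (\<forall>x \<in> \<Omega>. \<forall>y \<in> \<Omega>. x \<noteq> y \<longrightarrow> size (filter_mset (\<lambda>L. x \<in> L \<and> y \<in> L) B) = lam)"

text \<open>Supersimple: distinct lines (distinct members of the multiset, so in particular
  no repeated line) meet in at most two points.\<close>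
definition supersimple :: "'a set multiset \<Rightarrow> bool" where
  "supersimple B \<longleftrightarrow> (\<forall>L. count B L \<le> 1) \<and>
     (\<forall>L1 \<in># B. \<forall>L2 \<in># B. L1 \<noteq> L2 \<longrightarrow> card (L1 \<inter> L2) \<le> 2)"

definition property_triangle :: "'a set multiset \<Rightarrow> bool" where
  "property_triangle B \<longleftrightarrow> (\<forall>L1 \<in># B. \<forall>L2 \<in># B. card (L1 \<inter> L2) = 2 \<longrightarrow>
      ((L1 - L2) \<union> (L2 - L1)) \<in># B)"

definition collinear_triples :: "'a set \<Rightarrow> 'a set multiset \<Rightarrow> 'a set set" where
  "collinear_triples \<Omega> B = {T. T \<subseteq> \<Omega> \<and> card T = 3 \<and> (\<exists>L \<in># B. T \<subseteq> L)}"

definition regular_two_graph :: "'a set \<Rightarrow> 'a set set \<Rightarrow> bool" where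
  "regular_two_graph \<Omega> C \<longleftrightarrow> finite \<Omega> \<and> (\<forall>T \<in> C. T \<subseteq> \<Omega> \<and> card T = 3) \<and>
     (\<exists>mu::nat. \<forall>x \<in> \<Omega>. \<forall>y \<in> \<Omega>. x \<noteq> y \<longrightarrow> card {T \<in> C. x \<in> T \<and> y \<in> T} = mu) \<and>
     (\<forall>S. S \<subseteq> \<Omega> \<longrightarrow> card S = 4 \<longrightarrow> card {T \<in> C. T \<subseteq> S} \<in> {0, 2, 4})"

definition pair_swap :: "'a set \<Rightarrow> 'a \<Rightarrow> 'a" where
  "pair_swap S = (\<lambda>x. if x \<in> S then (THE y. y \<in> S \<and> y \<noteq> x) else x)"

text \<open>Permutations act on the right; the product sigma tau (first sigma, then tau)
  is the function tau o sigma.  [a,b] = (a,b) prod_i (a_i,b_i), the product over the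
  lines {a,b,a_i,b_i} through a and b; [a,a] = 1.\<close>
definition move :: "'a set multiset \<Rightarrow> 'a \<Rightarrow> 'a \<Rightarrow> ('a \<Rightarrow> 'a)" where
  "move B a b = (if a = b then id else
     fold_mset (\<lambda>L f. pair_swap (L - {a, b}) \<circ> f) (transpose a b)
       (filter_mset (\<lambda>L. a \<in> L \<and> b \<in> L) B))"

fun move_seq :: "'a set multiset \<Rightarrow> 'a list \<Rightarrow> ('a \<Rightarrow> 'a)" where
  "move_seq B [] = id"
| "move_seq B [a] = id"
| "move_seq B (a # b # rest) = move_seq B (b # rest) \<circ> move B a b"

definition L_inf :: "'a set \<Rightarrow> 'a set multiset \<Rightarrow> 'a \<Rightarrow> ('a \<Rightarrow> 'a) monoid" where
  "L_inf \<Omega> B z = \<lparr> carrier = {move_seq B (z # as) | as. set as \<subseteq> \<Omega>},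
                     monoid.mult = (\<lambda>\<sigma> \<tau>. \<tau> \<circ> \<sigma>), one = id \<rparr>"

definition point_stabilizer :: "('a \<Rightarrow> 'a) monoid \<Rightarrow> 'a \<Rightarrow> ('a \<Rightarrow> 'a) monoid" where
  "point_stabilizer G x = G\<lparr> carrier := {g \<in> carrier G. g x = x} \<rparr>"

text \<open>The vector space GF(2)^{2m}, realised as subsets of {0..<2m}
  (coordinate vectors), with addition = symmetric difference.\<close>
definition sp_vecs :: "nat \<Rightarrow> nat set set" where
  "sp_vecs m = Pow {..<2*m}"

definition vadd :: "nat set \<Rightarrow> nat set \<Rightarrow> nat set" where
  "vadd S T = (S - T) \<union> (T - S)"

text \<open>Standard non-degenerate alternating form: sum over i<m of
  u_{2i} v_{2i+1} + u_{2i+1} v_{2i} over GF(2).\<close>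
definition symp_form :: "nat \<Rightarrow> nat set \<Rightarrow> nat set \<Rightarrow> bool" where
  "symp_form m S T \<longleftrightarrow>
     odd (card {i. i < m \<and> 2*i \<in> S \<and> 2*i+1 \<in> T} + card {i. i < m \<and> 2*i+1 \<in> S \<and> 2*i \<in> T})"

definition Sp2 :: "nat \<Rightarrow> (nat set \<Rightarrow> nat set) monoid" where
  "Sp2 m = \<lparr> carrier = {g. g \<in> extensional (sp_vecs m) \<and> bij_betw g (sp_vecs m) (sp_vecs m) \<and>
                 (\<forall>S \<in> sp_vecs m. \<forall>T \<in> sp_vecs m. g (vadd S T) = vadd (g S) (g T)) \<and>
                 (\<forall>S \<in> sp_vecs m. \<forall>T \<in> sp_vecs m. symp_form m (g S) (g T) = symp_form m S T)},
             monoid.mult = (\<lambda>g h. compose (sp_vecs m) g h),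
             one = restrict id (sp_vecs m) \<rparr>"

definition elem_abelian_2_subgroup :: "('g, 'b) monoid_scheme \<Rightarrow> 'g set \<Rightarrow> nat \<Rightarrow> bool" where
  "elem_abelian_2_subgroup G E k \<longleftrightarrow> subgroup E G \<and> comm_group (G\<lparr>carrier := E\<rparr>) \<and>
     (\<forall>x \<in> E. x \<otimes>\<^bsub>G\<^esub> x = \<one>\<^bsub>G\<^esub>) \<and> finite E \<and> card E = 2 ^ k"

definition is_2_2m_Sp :: "('g, 'b) monoid_scheme \<Rightarrow> nat \<Rightarrow> bool" where
  "is_2_2m_Sp G m \<longleftrightarrow> (\<exists>E. E \<lhd> G \<and> elem_abelian_2_subgroup G E (2*m) \<and> (G Mod E) \<cong> Sp2 m)"

end

theory Submission
  imports Defs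
begin

text \<open>
  By property \<open>(\<triangle>)\<close> the relation \<^emph>\<open>equal, or forming a line\<close> on pairs of points is an equivalence
  relation, and the move \<open>[a,b]\<close> swaps the two points of every pair equivalent to \<open>{a,b}\<close>. The two-graph
  condition says that non-collinearity is a 2-cocycle modulo 2, which makes every move an automorphism
  of the design; hence \<open>G\<close> is generated by all moves, and two moves whose supports meet either agree,
  commute or have a product of order 3.

  Let \<open>A\<close> be a non-trivial abelian normal subgroup of \<open>G\<close> (the last non-trivial term of the derived
  series of the given solvable one). For \<open>s\<close> in \<open>A\<close> the product of \<open>[x,y]\<close> and its conjugate \<open>[xs,ys]\<close>
  lies in \<open>A\<close>, and \<open>A\<close> contains no product of two distinct moves with intersecting supports. So
  \<open>[x,y]\<close> and \<open>[xs,ys]\<close> agree or have disjoint supports, which forces \<open>A\<close> to be a regular elementary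
  abelian 2-group. Identifying \<open>\<Omega>\<close> with \<open>A\<close> by a base point \<open>z\<close>, non-collinearity with \<open>z\<close> becomes a
  non-degenerate alternating form, and the moves fixing \<open>z\<close> are exactly its transvections. These
  generate the symplectic group, which is therefore the point stabilizer, and a complement to \<open>A\<close>.
\<close>

section \<open>The design and its moves\<close>

lemma doubleton_other_unique: "c \<noteq> d \<Longrightarrow> (THE y. y \<in> {c, d} \<and> y \<noteq> c) = d"
  by (rule the_equality) auto

lemma pair_swap_doubleton: "c \<noteq> d \<Longrightarrow> pair_swap {c, d} = transpose c d"
  using doubleton_other_unique[of c d] doubleton_other_unique[of d c]
  by (auto simp: pair_swap_def transpose_def fun_eq_iff insert_commute)

lemma transpose_disjoint_commute:
  assumes "{a, b} \<inter> {c, d} = {}"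
  shows "transpose a b \<circ> transpose c d = transpose c d \<circ> transpose a b"
  using assms by (auto simp: fun_eq_iff transpose_def)

locale triangle_design =
  fixes \<Omega> :: "'a set" and B :: "'a set multiset" and n lam :: nat
  assumes design: "design_2_4 \<Omega> B n lam"
    and supersimple: "supersimple B"
    and triangle: "property_triangle B"
    and two_graph: "regular_two_graph \<Omega> (collinear_triples \<Omega> B)"
    and large: "n > 2 * lam + 2"
begin

abbreviation t :: "'a \<Rightarrow> 'a \<Rightarrow> 'a \<Rightarrow> 'a" where "t \<equiv> move B"

text \<open>Degenerate triples count as collinear, so that \<open>noncoll\<close> satisfies the cocycle identity without
  side conditions and the support of \<open>t a b\<close> is \<open>{x. \<not> noncoll a b x}\<close>.\<close>
definition noncoll :: "'a \<Rightarrow> 'a \<Rightarrow> 'a \<Rightarrow> bool" where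
  "noncoll a b c \<longleftrightarrow> a \<noteq> b \<and> a \<noteq> c \<and> b \<noteq> c \<and> (\<forall>d. {a, b, c, d} \<notin># B)"

section \<open>Lines and their symmetric differences\<close>

lemma finite_points: "finite \<Omega>"
  using design by (simp add: design_2_4_def)

lemma line_subset: "L \<in># B \<Longrightarrow> L \<subseteq> \<Omega>"
  using design by (auto simp: design_2_4_def)

lemma line_card: "L \<in># B \<Longrightarrow> card L = 4"
  using design by (auto simp: design_2_4_def)

lemma line_distinct:
  assumes "{a, b, c, d} \<in># B" shows "distinct [a, b, c, d]"
  using card_distinct[of "[a, b, c, d]"] line_card[OF assms] by simp

lemma line_points: "{a, b, c, d} \<in># B \<Longrightarrow> a \<in> \<Omega> \<and> b \<in> \<Omega> \<and> c \<in> \<Omega> \<and> d \<in> \<Omega>"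
  using line_subset by auto

lemma line_through_two:
  assumes "L \<in># B" "a \<in> L" "b \<in> L" "a \<noteq> b"
  obtains c d where "L = {a, b, c, d}" "distinct [a, b, c, d]"
proof -
  have fin: "finite L" using line_card[OF assms(1)] card.infinite by fastforce
  have "card (L - {a, b}) = 2"
    using assms fin line_card[OF assms(1)] by (simp add: card_Diff_subset)
  then obtain c d where cd: "L - {a, b} = {c, d}" "c \<noteq> d" by (auto simp: card_2_iff)
  then have "L = {a, b, c, d}" using assms by auto
  then show thesis using that line_distinct assms(1) by blast
qed

lemma line_through_three:
  assumes "L \<in># B" "a \<in> L" "b \<in> L" "c \<in> L" "a \<noteq> b" "a \<noteq> c" "b \<noteq> c"
  obtains d where "L = {a, b, c, d}"
proof -
  obtain x y where xy: "L = {a, b, x, y}" using line_through_two[OF assms(1-3,5)] by metis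
  then have "c = x \<or> c = y" using assms by auto
  moreover have "{a, b, x, y} = {a, b, y, x}" by auto
  ultimately show thesis using that xy by metis
qed

lemma lines_eqI:
  assumes "L \<in># B" "K \<in># B" "a \<in> L \<inter> K" "b \<in> L \<inter> K" "c \<in> L \<inter> K" "a \<noteq> b" "a \<noteq> c" "b \<noteq> c"
  shows "L = K"
proof (rule ccontr)
  assume "L \<noteq> K"
  then have "card (L \<inter> K) \<le> 2" using supersimple assms(1,2) by (auto simp: supersimple_def)
  moreover have "finite (L \<inter> K)" using assms(1) line_subset finite_points finite_subset by blast
  then have "card {a, b, c} \<le> card (L \<inter> K)" using assms by (intro card_mono) auto
  ultimately show False using assms by simp
qed

lemma line_perms:
  assumes "{a, b, c, d} \<in># B"
  shows "{b, a, c, d} \<in># B" "{a, b, d, c} \<in># B" "{a, c, b, d} \<in># B" "{c, d, a, b} \<in># B"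
proof -
  have "{b, a, c, d} = {a, b, c, d}" "{a, b, d, c} = {a, b, c, d}" "{a, c, b, d} = {a, b, c, d}"
    "{c, d, a, b} = {a, b, c, d}" by blast+
  then show "{b, a, c, d} \<in># B" "{a, b, d, c} \<in># B" "{a, c, b, d} \<in># B" "{c, d, a, b} \<in># B"
    using assms by argo+
qed

text \<open>Supersimplicity leaves only \<open>a\<close> and \<open>b\<close> in the intersection,
  so the triangle property applies. Read on pairs of points, this is transitivity of forming a
  line.\<close>

lemma line_sym_diff:
  assumes "{a, b, c, d} \<in># B" "{a, b, e, f} \<in># B" "{c, d} \<noteq> {e, f}"
  shows "{c, d, e, f} \<in># B"
proof -
  note D = line_distinct[OF assms(1)] line_distinct[OF assms(2)]
  have ne: "{a, b, c, d} \<noteq> {a, b, e, f}" using assms(3) D by auto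
  have disj: "x \<notin> {e, f}" if "x \<in> {c, d}" for x
    using lines_eqI[OF assms(1,2), of a b x] D that ne by auto
  have "{a, b, c, d} \<inter> {a, b, e, f} = {a, b}" using disj D by auto
  then have "card ({a, b, c, d} \<inter> {a, b, e, f}) = 2" using D by simp
  then have "({a, b, c, d} - {a, b, e, f}) \<union> ({a, b, e, f} - {a, b, c, d}) \<in># B"
    using triangle assms(1,2) unfolding property_triangle_def by blast
  moreover have "({a, b, c, d} - {a, b, e, f}) \<union> ({a, b, e, f} - {a, b, c, d}) = {c, d, e, f}"
    using D disj by auto
  ultimately show ?thesis by simp
qed

section \<open>Moves as permutations of points\<close>

lemma move_fold:
  assumes "a \<noteq> b" "finite F" "F \<subseteq> {L. L \<in># B \<and> a \<in> L \<and> b \<in> L}"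
  defines "f \<equiv> Finite_Set.fold (\<lambda>L f. pair_swap (L - {a, b}) \<circ> f) (transpose a b) F"
  shows "f a = b \<and> f b = a \<and> (\<forall>x y. {a, b, x, y} \<in> F \<longrightarrow> f x = y) \<and>
    (\<forall>x. x \<notin> {a, b} \<longrightarrow> (\<forall>L\<in>F. x \<notin> L) \<longrightarrow> f x = x)"
proof -
  define S where "S = {L. L \<in># B \<and> a \<in> L \<and> b \<in> L}"
  define g where "g = (\<lambda>L (f :: 'a \<Rightarrow> 'a). pair_swap (L - {a, b}) \<circ> f)"
  have S: "\<exists>x y. L = {a, b, x, y} \<and> distinct [a, b, x, y] \<and> pair_swap (L - {a, b}) = transpose x y"
    if "L \<in> S" for L
  proof -
    obtain x y where xy: "L = {a, b, x, y}" "distinct [a, b, x, y]"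
      using line_through_two[of L a b] \<open>L \<in> S\<close> \<open>a \<noteq> b\<close> unfolding S_def by blast
    then have "L - {a, b} = {x, y}" by auto
    then show ?thesis using xy pair_swap_doubleton[of x y] by (metis distinct_length_2_or_more)
  qed
  \<comment> \<open>Lines through \<open>a\<close> and \<open>b\<close> share no third point, so
    their transpositions commute and the fold does not depend on the order.\<close>
  have disj: "L = K" if "L \<in> S" "K \<in> S" "x \<in> L" "x \<in> K" "x \<notin> {a, b}" for L K x
    using lines_eqI[of L K a b x] that \<open>a \<noteq> b\<close> by (auto simp: S_def)
  interpret comp_fun_commute_on S g
  proof
    fix L K assume LK: "L \<in> S" "K \<in> S"
    show "g K \<circ> g L = g L \<circ> g K"
    proof (cases "L = K")
      case False
      obtain x y where xy: "L = {a, b, x, y}" "distinct [a, b, x, y]"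
         "pair_swap (L - {a, b}) = transpose x y" using S[OF LK(1)] by blast
      obtain u v where uv: "K = {a, b, u, v}" "distinct [a, b, u, v]"
         "pair_swap (K - {a, b}) = transpose u v" using S[OF LK(2)] by blast
      have "x \<notin> {u, v}" "y \<notin> {u, v}"
        using disj[OF LK, of x] disj[OF LK, of y] False xy(1,2) uv(1) by auto
      then have "{x, y} \<inter> {u, v} = {}" by simp
      then show ?thesis using transpose_disjoint_commute[of x y u v]
        by (simp add: g_def xy(3) uv(3) fun_eq_iff)
    qed simp
  qed
  have "finite F \<Longrightarrow> F \<subseteq> S \<Longrightarrow> Finite_Set.fold g (transpose a b) F a = b \<and>
    Finite_Set.fold g (transpose a b) F b = a \<and>
    (\<forall>x y. {a, b, x, y} \<in> F \<longrightarrow> Finite_Set.fold g (transpose a b) F x = y) \<and>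
    (\<forall>x. x \<notin> {a, b} \<longrightarrow> (\<forall>L\<in>F. x \<notin> L) \<longrightarrow> Finite_Set.fold g (transpose a b) F x = x)"
  proof (induction F rule: finite_induct)
    case empty
    then show ?case by simp
  next
    case (insert L F)
    let ?f = "Finite_Set.fold g (transpose a b) F"
    have sub: "F \<subseteq> S" "L \<in> S" using insert.prems by auto
    note IH = insert.IH[OF sub(1)]
    obtain u v where uv: "L = {a, b, u, v}" "distinct [a, b, u, v]"
       "pair_swap (L - {a, b}) = transpose u v" using S[OF sub(2)] by blast
    have eq: "Finite_Set.fold g (transpose a b) (insert L F) = transpose u v \<circ> ?f"
      using fold_insert[OF insert.prems insert.hyps] uv(3) by (simp add: g_def)
    have notF: "\<forall>K\<in>F. u \<notin> K \<and> v \<notin> K"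
      proof (intro ballI conjI notI)
      fix K assume K: "K \<in> F"
      show "u \<in> K \<Longrightarrow> False" "v \<in> K \<Longrightarrow> False"
        using disj[OF sub(2), of K u] disj[OF sub(2), of K v] K sub(1) insert.hyps uv(1,2) by auto
    qed
    then have fu: "?f u = u" "?f v = v" using IH uv(2) by auto
    have c: "(transpose u v \<circ> ?f) x = y" if xy: "{a, b, x, y} \<in> insert L F" for x y
    proof (cases "{a, b, x, y} = L")
      case True
      have "{a, b, x, y} \<in># B" using True sub by (simp add: S_def)
      then have "distinct [a, b, x, y]" by (rule line_distinct)
      then have "{a, b, x, y} - {a, b} = {x, y}" "{a, b, u, v} - {a, b} = {u, v}" using uv(2) by auto
      then have "{x, y} = {u, v}" using True uv(1) by metis
      then have "x = u \<and> y = v \<or> x = v \<and> y = u" by (simp add: doubleton_eq_iff)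
      then show ?thesis using fu by auto
    next
      case False
      then have F: "{a, b, x, y} \<in> F" using xy by simp
      then have "y \<noteq> u" "y \<noteq> v" using notF by auto
      then show ?thesis using IH F by auto
    qed
    have d: "(transpose u v \<circ> ?f) x = x" if "x \<notin> {a, b}" "\<forall>K\<in>insert L F. x \<notin> K" for x
      using that uv(1) IH by auto
    show ?case unfolding eq using c d uv(2) IH by auto
  qed
  then show ?thesis using assms(2,3) by (simp add: f_def S_def g_def)
qed

text \<open>Supersimplicity excludes repeated lines, so the multiset fold in \<open>move\<close>
  becomes a fold over a set. This pointwise description replaces the fold in all later
  arguments.\<close>

lemma move_facts:
  assumes "a \<noteq> b"
  shows "t a b a = b \<and> t a b b = a \<and> (\<forall>x y. {a, b, x, y} \<in># B \<longrightarrow> t a b x = y) \<and>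
    (\<forall>x. noncoll a b x \<longrightarrow> t a b x = x)"
proof -
  let ?M = "filter_mset (\<lambda>L. a \<in> L \<and> b \<in> L) B"
  let ?h = "\<lambda>L (f :: 'a \<Rightarrow> 'a). pair_swap (L - {a, b}) \<circ> f"
  have cnt: "count ?M L = 1" if "L \<in># ?M" for L
  proof -
    have "count B L \<le> 1" "count B L > 0" using supersimple that by (auto simp: supersimple_def)
    then have "count B L = 1" by linarith
    then show ?thesis using that by simp
  qed
  \<comment> \<open>\<open>fold_mset\<close> iterates each factor according to its multiplicity,
    which is always 1 here.\<close>
  have "Finite_Set.fold (\<lambda>L. ?h L ^^ count ?M L) (transpose a b) (set_mset ?M)
      = Finite_Set.fold ?h (transpose a b) (set_mset ?M)"
    by (rule fold_closed_eq[where B = UNIV]) (use cnt in auto)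
  then have eq: "t a b = Finite_Set.fold ?h (transpose a b) (set_mset ?M)"
    using assms by (simp add: move_def fold_mset_def)
  have *: "x \<notin> L" if "noncoll a b x" "L \<in># B" "a \<in> L" "b \<in> L" for x L
  proof
    assume "x \<in> L"
    moreover have "a \<noteq> x" "b \<noteq> x" "\<And>d. {a, b, x, d} \<notin># B" using that(1) by (auto simp: noncoll_def)
    ultimately show False using line_through_three[of L a b x] that assms by metis
  qed
  have F: "t a b a = b" "t a b b = a" "\<And>x y. {a, b, x, y} \<in># ?M \<Longrightarrow> t a b x = y"
    "\<And>x. x \<notin> {a, b} \<Longrightarrow> (\<And>L. L \<in># ?M \<Longrightarrow> x \<notin> L) \<Longrightarrow> t a b x = x"
    using move_fold[OF assms, of "set_mset ?M"] unfolding eq[symmetric] by simp_all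
  have "t a b x = x" if "noncoll a b x" for x
    by (rule F(4)) (use * that in \<open>auto simp: noncoll_def\<close>)
  moreover have "t a b x = y" if "{a, b, x, y} \<in># B" for x y
    by (rule F(3)) (use that in simp)
  ultimately show ?thesis using F(1,2) by blast
qed

lemma move_same [simp]: "t a a = id"
  by (simp add: move_def)

lemma move_left [simp]: "t a b a = b"
  using move_facts by (cases "a = b") auto

lemma move_right [simp]: "t a b b = a"
  using move_facts by (cases "a = b") auto

lemma move_line: "{a, b, x, y} \<in># B \<Longrightarrow> t a b x = y"
  using move_facts line_distinct by fastforce

lemma move_fixes: "noncoll a b x \<Longrightarrow> t a b x = x"
  using move_facts by (auto simp: noncoll_def)

lemma noncoll_cases:
  assumes "\<not> noncoll a b x" "a \<noteq> b"
  obtains "x = a" | "x = b" | y where "{a, b, x, y} \<in># B"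
  using assms by (auto simp: noncoll_def)

lemma noncoll_degenerate [simp]: "\<not> noncoll a a b" "\<not> noncoll a b a" "\<not> noncoll b a a"
  by (auto simp: noncoll_def)

lemma noncoll_swap12: "noncoll a b c = noncoll b a c"
  using line_perms(1) unfolding noncoll_def by metis

lemma noncoll_swap23: "noncoll a b c = noncoll a c b"
  using line_perms(3) unfolding noncoll_def by metis

lemma noncoll_line: "{a, b, c, d} \<in># B \<Longrightarrow> \<not> noncoll a b c"
  by (auto simp: noncoll_def)

lemma move_fixed_iff:
  assumes "a \<noteq> b" shows "t a b x = x \<longleftrightarrow> noncoll a b x"
proof
  assume eq: "t a b x = x"
  show "noncoll a b x"
  proof (rule ccontr)
    assume "\<not> noncoll a b x"
    then show False using assms
    proof (cases rule: noncoll_cases)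
      case (3 y)
      then show False using move_line[OF 3] line_distinct[OF 3] eq by simp
    qed (use eq assms in auto)
  qed
qed (rule move_fixes)

lemma move_involutive [simp]: "t a b (t a b x) = x"
proof (cases "noncoll a b x \<or> a = b")
  case False
  then have "\<not> noncoll a b x" "a \<noteq> b" by auto
  then show ?thesis
  proof (cases rule: noncoll_cases)
    case (3 y)
    then have "{a, b, y, x} \<in># B" by (rule line_perms)
    then show ?thesis using 3 move_line by metis
  qed auto
qed (auto simp: move_fixes)

lemma move_comp_self [simp]: "t a b \<circ> t a b = id"
  by (simp add: fun_eq_iff)

text \<open>Symmetric differences with \<open>{a, b, c, d}\<close> turn lines on \<open>a, b\<close>
  into lines on \<open>c, d\<close>; the four points of that line itself are checked
  directly.\<close>

lemma move_eq_on_line_aux: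
  assumes "{a, b, c, d} \<in># B" "\<not> noncoll a b x"
  shows "\<not> noncoll c d x \<and> t c d x = t a b x"
proof -
  note D = line_distinct[OF assms(1)]
  have L: "{c, d, a, b} \<in># B" "{c, d, b, a} \<in># B" "{a, b, d, c} \<in># B"
    using line_perms assms(1) by blast+
  have ne: "a \<noteq> b" using D by simp
  show ?thesis using assms(2) ne
  proof (cases rule: noncoll_cases)
    case 1
    then show ?thesis using move_line[OF L(1)] noncoll_line[OF L(1)] by auto
  next
    case 2
    then show ?thesis using move_line[OF L(2)] noncoll_line[OF L(2)] by auto
  next
    case (3 y)
    have y: "t a b x = y" using move_line 3 .
    show ?thesis
    proof (cases "{c, d} = {x, y}")
      case True
      then show ?thesis using y move_line[OF L(3)] move_line[OF assms(1)]
        by (auto simp: doubleton_eq_iff)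
    next
      case False
      have "{c, d, x, y} \<in># B" using line_sym_diff[OF assms(1) 3 False] .
      then show ?thesis using y move_line noncoll_line by auto
    qed
  qed
qed

lemma noncoll_eq_on_line:
  assumes "{a, b, c, d} \<in># B" shows "noncoll a b x = noncoll c d x"
proof -
  have "{c, d, a, b} \<in># B" using assms by (rule line_perms)
  then show ?thesis using move_eq_on_line_aux assms by blast
qed

lemma move_eq_on_line:
  assumes "{a, b, c, d} \<in># B" shows "t a b = t c d"
proof
  fix x
  show "t a b x = t c d x"
    using move_eq_on_line_aux[OF assms, of x] noncoll_eq_on_line[OF assms, of x] move_fixes by metis
qed

lemma move_commute: "t a b = t b a"
proof (cases "a = b")
  case False
  have "t a b x = t b a x" for x
  proof (cases "noncoll a b x")
    case True
    then show ?thesis using move_fixes noncoll_swap12 by metis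
  next
    case F: False
    show ?thesis using F False
    proof (cases rule: noncoll_cases)
      case (3 y)
      then have "{b, a, x, y} \<in># B" by (rule line_perms)
      then show ?thesis using 3 move_line by metis
    qed auto
  qed
  then show ?thesis by blast
qed simp

text \<open>The pair of \<open>x\<close> and its image is equivalent to \<open>{a, b}\<close>. Any
  point of the support can thus serve as first argument, which later gives two moves with
  intersecting supports a common first point.\<close>

lemma move_eq_support:
  assumes "\<not> noncoll a b x" "a \<noteq> b"
  shows "t a b = t x (t a b x)"
  using assms
proof (cases rule: noncoll_cases)
  case 2
  then show ?thesis using move_commute by auto
next
  case (3 y)
  then show ?thesis using move_line move_eq_on_line by metis
qed auto

lemma noncoll_move_eq: "t a b = t c d \<Longrightarrow> a \<noteq> b \<Longrightarrow> c \<noteq> d \<Longrightarrow> noncoll a b x = noncoll c d x"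
  using move_fixed_iff by metis

lemma move_in_points: "a \<in> \<Omega> \<Longrightarrow> b \<in> \<Omega> \<Longrightarrow> x \<in> \<Omega> \<Longrightarrow> t a b x \<in> \<Omega>"
proof (cases "noncoll a b x \<or> a = b")
  case False
  then have "\<not> noncoll a b x" "a \<noteq> b" by auto
  then show "a \<in> \<Omega> \<Longrightarrow> b \<in> \<Omega> \<Longrightarrow> x \<in> \<Omega> \<Longrightarrow> t a b x \<in> \<Omega>"
  proof (cases rule: noncoll_cases)
    case (3 y)
    then show ?thesis using move_line[OF 3] line_points[OF 3] by simp
  qed auto
qed (auto simp: move_fixes)

lemma move_outside: "a \<in> \<Omega> \<Longrightarrow> b \<in> \<Omega> \<Longrightarrow> x \<notin> \<Omega> \<Longrightarrow> t a b x = x"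
  using move_fixes[of a b x] line_points[of a b x] by (cases "a = b") (auto simp: noncoll_def)

section \<open>The two-graph condition as a cocycle, and the supports of moves\<close>

lemma noncoll_iff_not_collinear:
  assumes "a \<in> \<Omega>" "b \<in> \<Omega>" "c \<in> \<Omega>" "a \<noteq> b" "a \<noteq> c" "b \<noteq> c"
  shows "noncoll a b c \<longleftrightarrow> {a, b, c} \<notin> collinear_triples \<Omega> B"
proof -
  have "{a, b, c} \<in> collinear_triples \<Omega> B \<longleftrightarrow> (\<exists>L. L \<in># B \<and> a \<in> L \<and> b \<in> L \<and> c \<in> L)"
    using assms by (auto simp: collinear_triples_def)
  also have "\<dots> \<longleftrightarrow> (\<exists>d. {a, b, c, d} \<in># B)"
  proof
    assume "\<exists>L. L \<in># B \<and> a \<in> L \<and> b \<in> L \<and> c \<in> L"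
    then obtain L where L: "L \<in># B" "a \<in> L" "b \<in> L" "c \<in> L" by blast
    then show "\<exists>d. {a, b, c, d} \<in># B" using line_through_three[OF L assms(4-6)] by metis
  qed blast
  finally show ?thesis using assms by (auto simp: noncoll_def)
qed

text \<open>A 4-set contains an even number of collinear triples, hence of non-collinear ones. If
  two arguments coincide, degenerate triples count as collinear and the symmetry of
  \<open>noncoll\<close> suffices.\<close>

lemma noncoll_cocycle:
  assumes "a \<in> \<Omega>" "b \<in> \<Omega>" "c \<in> \<Omega>" "d \<in> \<Omega>"
  shows "(noncoll a b c = noncoll a b d) = (noncoll a c d = noncoll b c d)"
proof (cases "distinct [a, b, c, d]")
  case False
  then consider "a = b" | "a = c" | "a = d" | "b = c" | "b = d" | "c = d" by auto
  then show ?thesis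
    by cases (simp_all, (metis noncoll_swap12 noncoll_swap23)+)
next
  case D: True
  let ?S = "{a, b, c, d}" and ?C = "collinear_triples \<Omega> B"
  \<comment> \<open>Each triple inside the 4-set omits exactly one point, so triples are counted by
    the omitted point.\<close>
  have "{T \<in> ?C. T \<subseteq> ?S} = (\<lambda>x. ?S - {x}) ` {x \<in> ?S. ?S - {x} \<in> ?C}"
  proof (intro equalityI subsetI)
    fix T assume T: "T \<in> {T \<in> ?C. T \<subseteq> ?S}"
    then have "card (?S - T) = 1"
      using D by (subst card_Diff_subset) (auto simp: collinear_triples_def intro: finite_subset)
    then obtain x where "?S - T = {x}" by (auto simp: card_1_singleton_iff)
    then have "T = ?S - {x}" "x \<in> ?S" using T by auto
    then show "T \<in> (\<lambda>x. ?S - {x}) ` {x \<in> ?S. ?S - {x} \<in> ?C}" using T by auto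
  qed auto
  moreover have "inj_on (\<lambda>x. ?S - {x}) {x \<in> ?S. ?S - {x} \<in> ?C}" by (auto simp: inj_on_def)
  ultimately have "card {T \<in> ?C. T \<subseteq> ?S} = card {x \<in> ?S. ?S - {x} \<in> ?C}"
    by (simp add: card_image)
  also have "\<dots> = (\<Sum>x\<in>?S. if ?S - {x} \<in> ?C then 1 else 0)"
    by (simp add: sum.If_cases Int_def card_eq_sum del: sum_constant)
  also have "\<dots> = (if noncoll b c d then 0 else 1) + (if noncoll a c d then 0 else 1)
      + (if noncoll a b d then 0 else 1) + (if noncoll a b c then 0 else 1 :: nat)"
  proof -
    have "?S - {a} = {b, c, d}" "?S - {b} = {a, c, d}" "?S - {c} = {a, b, d}" "?S - {d} = {a, b, c}"
      using D by auto
    then show ?thesis using D assms by (simp add: noncoll_iff_not_collinear)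
  qed
  finally have eq: "card {T \<in> ?C. T \<subseteq> ?S} = \<dots>" .
  have "card {T \<in> ?C. T \<subseteq> ?S} \<in> {0, 2, 4}"
  proof -
    have "?S \<subseteq> \<Omega>" "card ?S = 4" using assms D by auto
    then show ?thesis using two_graph unfolding regular_two_graph_def by blast
  qed
  then show ?thesis unfolding eq
    by (cases "noncoll a b c"; cases "noncoll a b d"; cases "noncoll a c d"; cases "noncoll b c d") simp_all
qed

text \<open>Each of the \<open>lam\<close> lines on \<open>a, b\<close> adds two points, and none is
  counted twice because these lines meet only in \<open>a\<close> and \<open>b\<close>.\<close>

lemma card_support:
  assumes "a \<in> \<Omega>" "b \<in> \<Omega>" "a \<noteq> b"
  shows "card {x \<in> \<Omega>. \<not> noncoll a b x} = 2 * lam + 2"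
proof -
  let ?F = "{L. L \<in># B \<and> a \<in> L \<and> b \<in> L}"
  have fin: "finite ?F" by simp
  have F: "\<exists>x y. L = {a, b, x, y} \<and> distinct [a, b, x, y]" if "L \<in> ?F" for L
    using line_through_two[of L a b] that assms by blast
  have "size (filter_mset (\<lambda>L. a \<in> L \<and> b \<in> L) B) = card ?F"
  proof -
    have "count (filter_mset (\<lambda>L. a \<in> L \<and> b \<in> L) B) L = 1" if "L \<in> ?F" for L
    proof -
      have "count B L \<le> 1" "count B L > 0" using supersimple that by (auto simp: supersimple_def)
      then have "count B L = 1" by linarith
      then show ?thesis using that by simp
    qed
    then show ?thesis by (simp add: size_multiset_overloaded_eq)
  qed
  then have cF: "card ?F = lam" using design assms by (auto simp: design_2_4_def)
  have eq: "{x \<in> \<Omega>. \<not> noncoll a b x} = {a, b} \<union> (\<Union>L\<in>?F. L - {a, b})"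
  proof (intro equalityI subsetI)
    fix x assume "x \<in> {x \<in> \<Omega>. \<not> noncoll a b x}"
    then have "\<not> noncoll a b x" by simp
    then show "x \<in> {a, b} \<union> (\<Union>L\<in>?F. L - {a, b})" using assms(3)
    proof (cases rule: noncoll_cases)
      case (3 y)
      then show ?thesis by (intro UnI2 UN_I[of "{a, b, x, y}"]) (use line_distinct[OF 3] in auto)
    qed auto
  next
    fix x assume x: "x \<in> {a, b} \<union> (\<Union>L\<in>?F. L - {a, b})"
    show "x \<in> {x \<in> \<Omega>. \<not> noncoll a b x}"
    proof (cases "x \<in> {a, b}")
      case True
      then show ?thesis using assms by auto
    next
      case False
      then obtain L where L: "L \<in># B" "a \<in> L" "b \<in> L" "x \<in> L" using x by auto
      then obtain d where "L = {a, b, x, d}"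
        using line_through_three[of L a b x] False assms by blast
      then show ?thesis using L line_subset by (auto simp: noncoll_def)
    qed
  qed
  have U: "card (\<Union>L\<in>?F. L - {a, b}) = (\<Sum>L\<in>?F. card (L - {a, b}))"
  proof (rule card_UN_disjoint[OF fin])
    show "\<forall>L\<in>?F. finite (L - {a, b})" using F by fastforce
    show "\<forall>L\<in>?F. \<forall>K\<in>?F. L \<noteq> K \<longrightarrow> (L - {a, b}) \<inter> (K - {a, b}) = {}"
      using lines_eqI[of _ _ a b] assms(3) by blast
  qed
  have two: "card (L - {a, b}) = 2" if L: "L \<in> ?F" for L
  proof -
    obtain x y where "L = {a, b, x, y}" "distinct [a, b, x, y]" using F[OF L] by auto
    moreover from this have "L - {a, b} = {x, y}" by auto
    ultimately show ?thesis by simp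
  qed
  have "(\<Union>L\<in>?F. L - {a, b}) \<subseteq> \<Omega>" using line_subset by blast
  then have fU: "finite (\<Union>L\<in>?F. L - {a, b})" using finite_points finite_subset by blast
  have "card {x \<in> \<Omega>. \<not> noncoll a b x} = card {a, b} + card (\<Union>L\<in>?F. L - {a, b})"
    unfolding eq by (rule card_Un_disjoint) (use fU in auto)
  also have "card (\<Union>L\<in>?F. L - {a, b}) = (\<Sum>L\<in>?F. 2)"
    unfolding U using two by (intro sum.cong) auto
  finally show ?thesis using cF assms(3) by simp
qed

lemma exists_outside_support:
  assumes "a \<in> \<Omega>" "b \<in> \<Omega>" "a \<noteq> b"
  obtains x where "x \<in> \<Omega>" "noncoll a b x"
proof -
  have "card \<Omega> = n" using design by (simp add: design_2_4_def)
  then have "{x \<in> \<Omega>. \<not> noncoll a b x} \<noteq> \<Omega>" using card_support[OF assms] large by auto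
  then show thesis using that by auto
qed

lemma exists_line:
  assumes "a \<in> \<Omega>" "b \<in> \<Omega>" "a \<noteq> b"
  obtains x y where "{a, b, x, y} \<in># B"
proof -
  have "card {x \<in> \<Omega>. \<not> noncoll a b x} > 2"
    using card_support[OF assms] design by (simp add: design_2_4_def)
  moreover have "card {a, b} = 2" using assms by simp
  ultimately have "\<not> {x \<in> \<Omega>. \<not> noncoll a b x} \<subseteq> {a, b}"
    using card_mono[of "{a, b}" "{x \<in> \<Omega>. \<not> noncoll a b x}"] by auto
  then obtain x where "\<not> noncoll a b x" "x \<noteq> a" "x \<noteq> b" by auto
  then show thesis using that assms(3) noncoll_cases by metis
qed

text \<open>By the cocycle identity, the left side asks whether \<open>a\<close> and
  \<open>b\<close> lie on the same side of the support of \<open>t x y\<close>; that is also the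
  support of \<open>t z w\<close>. So a line meets every support in an even number of
  points.\<close>

lemma noncoll_even_on_line:
  assumes L: "{x, y, z, w} \<in># B" and ab: "a \<in> \<Omega>" "b \<in> \<Omega>"
  shows "(noncoll a b x = noncoll a b y) = (noncoll a b z = noncoll a b w)"
proof -
  note P = line_points[OF L]
  have "(noncoll a b x = noncoll a b y) = (noncoll a x y = noncoll b x y)" using noncoll_cocycle[OF ab] P by blast
  also have "\<dots> = (noncoll x y a = noncoll x y b)" using noncoll_swap12 noncoll_swap23 by metis
  also have "\<dots> = (noncoll z w a = noncoll z w b)" using noncoll_eq_on_line[OF L] by simp
  also have "\<dots> = (noncoll a z w = noncoll b z w)" using noncoll_swap12 noncoll_swap23 by metis
  also have "\<dots> = (noncoll a b z = noncoll a b w)" using noncoll_cocycle[OF ab] P by blast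
  finally show ?thesis .
qed

end

section \<open>The group generated by the moves\<close>

abbreviation perm_inv :: "('a \<Rightarrow> 'a) \<Rightarrow> 'a \<Rightarrow> 'a" where
  "perm_inv g \<equiv> inv_into UNIV g"

context triangle_design
begin

section \<open>Automorphisms of the design\<close>

definition automorphism :: "('a \<Rightarrow> 'a) \<Rightarrow> bool" where
  "automorphism g \<longleftrightarrow> bij g \<and> (\<forall>x. x \<notin> \<Omega> \<longrightarrow> g x = x) \<and> (\<forall>L. g ` L \<in># B \<longleftrightarrow> L \<in># B)"

lemma automorphism_line:
  assumes "automorphism g"
  shows "{g a, g b, g c, g d} \<in># B \<longleftrightarrow> {a, b, c, d} \<in># B"
proof -
  have "g ` {a, b, c, d} \<in># B \<longleftrightarrow> {a, b, c, d} \<in># B"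
    using assms unfolding automorphism_def by blast
  then show ?thesis by simp
qed

lemma automorphism_inj: "automorphism g \<Longrightarrow> g x = g y \<longleftrightarrow> x = y"
  unfolding automorphism_def by (simp add: bij_is_inj inj_eq)

lemma automorphism_noncoll:
  assumes "automorphism g" shows "noncoll (g a) (g b) (g c) = noncoll a b c"
proof -
  have "(\<forall>d. {g a, g b, g c, d} \<notin># B) = (\<forall>d. {g a, g b, g c, g d} \<notin># B)"
    using assms unfolding automorphism_def by (metis bij_pointE)
  then show ?thesis
    using automorphism_inj[OF assms] automorphism_line[OF assms] unfolding noncoll_def by simp
qed

text \<open>Moves are determined by the lines alone. This is the conjugation rule for moves, phrased
  without inverses.\<close>

lemma automorphism_move:
  assumes "automorphism g" shows "g (t a b x) = t (g a) (g b) (g x)"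
proof (cases "a = b \<or> noncoll a b x")
  case True
  then show ?thesis using automorphism_noncoll[OF assms] move_fixes by auto
next
  case False
  then have "\<not> noncoll a b x" "a \<noteq> b" by auto
  then show ?thesis
  proof (cases rule: noncoll_cases)
    case (3 y)
    then show ?thesis using automorphism_line[OF assms] move_line by metis
  qed auto
qed

lemma automorphism_points:
  assumes "automorphism g" shows "g x \<in> \<Omega> \<longleftrightarrow> x \<in> \<Omega>"
proof -
  have "y \<notin> \<Omega> \<Longrightarrow> g y = y" for y using assms by (simp add: automorphism_def)
  then show ?thesis using automorphism_inj[OF assms, of "g x" x] by metis
qed

lemma automorphism_id: "automorphism id"
  by (simp add: automorphism_def)

lemma automorphism_comp:
  assumes "automorphism g" "automorphism h" shows "automorphism (g \<circ> h)"
  unfolding automorphism_def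
proof (intro conjI allI impI)
  show "bij (g \<circ> h)" using assms by (simp add: automorphism_def bij_comp)
  show "(g \<circ> h) x = x" if "x \<notin> \<Omega>" for x using assms that by (simp add: automorphism_def)
  have "(g \<circ> h) ` L = g ` h ` L" for L by (rule image_comp[symmetric])
  then show "(g \<circ> h) ` L \<in># B \<longleftrightarrow> L \<in># B" for L
    using assms unfolding automorphism_def by metis
qed

text \<open>A line meets the support of \<open>t a b\<close> in 0, 2 or 4 points; in each case its image is
  obtained from it by symmetric differences with lines \<open>{x, t a b x, y, t a b y}\<close>.\<close>
lemma move_maps_line:
  assumes ab: "a \<in> \<Omega>" "b \<in> \<Omega>" "a \<noteq> b" and L: "L \<in># B"
  shows "t a b ` L \<in># B"
proof -
  let ?f = "t a b"
  \<comment> \<open>Both \<open>{x, ?f x}\<close> and \<open>{y, ?f y}\<close> are equivalent to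
    \<open>{a, b}\<close>, hence to each other; being different pairs, they form a line.\<close>
  have pair: "{x, ?f x, y, ?f y} \<in># B" if "\<not> noncoll a b x" "\<not> noncoll a b y" "y \<noteq> x" "y \<noteq> ?f x" for x y
  proof -
    have e: "?f = t x (?f x)" using move_eq_support[OF that(1) ab(3)] .
    have ne: "x \<noteq> ?f x" using move_fixed_iff[OF ab(3)] that(1) by metis
    have "\<not> noncoll x (?f x) y" using noncoll_move_eq[OF e ab(3) ne] that(2) by simp
    then obtain z where "{x, ?f x, y, z} \<in># B"
      using \<open>y \<noteq> x\<close> \<open>y \<noteq> ?f x\<close> ne noncoll_cases by metis
    then show ?thesis using move_line e by metis
  qed
  have fourth: "{?f x, ?f y, ?f z, ?f w} \<in># B"
    if xy: "{x, y, z, w} \<in># B" "\<not> noncoll a b x" "\<not> noncoll a b y" for x y z w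
  proof (cases "y = ?f x")
    case True
    have e: "?f = t x y" using move_eq_support[OF xy(2) ab(3)] True by simp
    have zw: "?f z = w" "?f w = z"
      using move_line[OF xy(1)] move_line[OF line_perms(2)[OF xy(1)]] e by simp_all
    have "?f x = y" "?f y = x" using True by simp_all
    then show ?thesis using zw line_perms(1)[OF line_perms(2)[OF xy(1)]] by simp
  next
    case y: False
    note D = line_distinct[OF xy(1)]
    have "{x, ?f x, y, ?f y} \<in># B" using pair[OF xy(2,3)] y D by auto
    then have q: "{x, y, ?f x, ?f y} \<in># B" by (rule line_perms)
    have par: "noncoll a b z = noncoll a b w" using noncoll_even_on_line[OF xy(1) ab(1,2)] xy(2,3) by simp
    show ?thesis
    proof (cases "noncoll a b z")
      case True
      then have zw: "?f z = z" "?f w = w" using par move_fixes by auto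
      have "\<not> noncoll a b (?f x)" using xy(2) move_fixed_iff[OF ab(3)] move_involutive by metis
      moreover have "\<not> noncoll a b (?f y)" using xy(3) move_fixed_iff[OF ab(3)] move_involutive by metis
      \<comment> \<open>The image pair lies in the support and \<open>z, w\<close> do not, so the
        symmetric difference of the line \<open>q\<close> with the given line is the image.\<close>
      ultimately have "{?f x, ?f y} \<noteq> {z, w}" using True by (auto simp: doubleton_eq_iff)
      then show ?thesis using line_sym_diff[OF q xy(1)] zw by simp
    next
      case z: False
      have e1: "t x y = t z w" using move_eq_on_line xy(1) .
      have e2: "t x y = t (?f x) (?f y)" using move_eq_on_line q .
      show ?thesis
      proof (cases "w = ?f z")
        case True
        have "?f = t z w" using move_eq_support[OF z ab(3)] True by simp
        then have "?f x = y" using e1 by (metis move_left)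
        then show ?thesis using y by simp
      next
        case False
        have "{z, ?f z, w, ?f w} \<in># B" using pair[of z w] False z par D by auto
        then have q2: "{z, w, ?f z, ?f w} \<in># B" by (rule line_perms)
        have e3: "t z w = t (?f z) (?f w)" using move_eq_on_line q2 .
        have inj: "?f p = ?f q \<longleftrightarrow> p = q" for p q by (metis move_involutive)
        then have ne: "?f z \<noteq> ?f x" "?f z \<noteq> ?f y" "?f z \<noteq> ?f w" "?f x \<noteq> ?f y"
          using D by auto
        \<comment> \<open>The pairs \<open>{x, y}\<close>, \<open>{z, w}\<close> and their images
          all define one move, so the move of the image of \<open>{x, y}\<close> exchanges
          \<open>?f z\<close> and \<open>?f w\<close>.\<close>
        have e4: "t (?f x) (?f y) (?f z) = ?f w" using e1 e2 e3 move_left by metis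
        have "\<not> noncoll (?f x) (?f y) (?f z)"
          using e4 move_fixes ne(3) by metis
        then obtain p where "{?f x, ?f y, ?f z, p} \<in># B"
          by (cases rule: noncoll_cases) (use ne in auto)
        then show ?thesis using e4 move_line by metis
      qed
    qed
  qed
  have main: "?f ` {x, y, z, w} \<in># B" if "{x, y, z, w} \<in># B" "\<not> noncoll a b x" "\<not> noncoll a b y" for x y z w
    using fourth[OF that] by simp
  show ?thesis
  proof (cases "\<forall>x\<in>L. noncoll a b x")
    case True
    then have "?f ` L = L" using move_fixes by (simp add: image_def)
    then show ?thesis using L by simp
  next
    case False
    then obtain x where x: "x \<in> L" "\<not> noncoll a b x" by auto
    have "card (L - {x}) = 3" using x line_card[OF L] by simp
    then obtain y where "y \<in> L" "y \<noteq> x" by (metis Diff_iff card.empty ex_in_conv insertI1 zero_neq_numeral)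
    then obtain z w where zw: "L = {x, y, z, w}" using line_through_two[OF L x(1)] by metis
    have xyz: "{x, y, z, w} \<in># B" "{x, z, y, w} \<in># B" "{x, w, y, z} \<in># B"
    proof -
      show *: "{x, y, z, w} \<in># B" using L zw by simp
      show "{x, z, y, w} \<in># B" using line_perms(3)[OF *] .
      show "{x, w, y, z} \<in># B" using line_perms(3)[OF line_perms(2)[OF *]] .
    qed
    have eq: "{x, z, y, w} = {x, y, z, w}" "{x, w, y, z} = {x, y, z, w}" by blast+
    have par: "(noncoll a b x = noncoll a b y) = (noncoll a b z = noncoll a b w)"
      using noncoll_even_on_line[OF xyz(1) ab(1,2)] .
    then consider "\<not> noncoll a b y" | "\<not> noncoll a b z" | "\<not> noncoll a b w" using x by blast
    then show ?thesis
    proof cases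
      case 1
      then show ?thesis using main[OF xyz(1) x(2)] zw by simp
    next
      case 2
      then show ?thesis using main[OF xyz(2) x(2)] zw eq by simp
    next
      case 3
      then show ?thesis using main[OF xyz(3) x(2)] zw eq by simp
    qed
  qed
qed

lemma move_automorphism:
  assumes "a \<in> \<Omega>" "b \<in> \<Omega>" shows "automorphism (t a b)"
proof (cases "a = b")
  case True
  then show ?thesis using automorphism_id by simp
next
  case False
  have "bij (t a b)" by (rule o_bij[of "t a b"]) simp_all
  moreover have "t a b ` L \<in># B \<longleftrightarrow> L \<in># B" for L
  proof
    assume "t a b ` L \<in># B"
    then have "t a b ` t a b ` L \<in># B" by (rule move_maps_line[OF assms False])
    then show "L \<in># B" by (simp add: image_image)
  qed (rule move_maps_line[OF assms False])
  ultimately show ?thesis using move_outside[OF assms] unfolding automorphism_def by blast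
qed

text \<open>Moves are involutions, so this monoid is already a group. Factors are added on the left
  only, as when a move sequence grows at its end.\<close>

definition moves_monoid :: "('a \<Rightarrow> 'a) set" where
  "moves_monoid = \<Inter> {M. id \<in> M \<and> (\<forall>g\<in>M. \<forall>a\<in>\<Omega>. \<forall>b\<in>\<Omega>. t a b \<circ> g \<in> M)}"

lemma moves_id: "id \<in> moves_monoid"
  by (simp add: moves_monoid_def)

lemma moves_step: "g \<in> moves_monoid \<Longrightarrow> a \<in> \<Omega> \<Longrightarrow> b \<in> \<Omega> \<Longrightarrow> t a b \<circ> g \<in> moves_monoid"
  by (auto simp: moves_monoid_def)

lemma moves_induct [consumes 1, case_names id step]:
  assumes "g \<in> moves_monoid" "P id"
    and "\<And>g a b. g \<in> moves_monoid \<Longrightarrow> P g \<Longrightarrow> a \<in> \<Omega> \<Longrightarrow> b \<in> \<Omega> \<Longrightarrow> P (t a b \<circ> g)"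
  shows "P g"
proof -
  let ?M = "{g \<in> moves_monoid. P g}"
  have "id \<in> ?M \<and> (\<forall>g\<in>?M. \<forall>a\<in>\<Omega>. \<forall>b\<in>\<Omega>. t a b \<circ> g \<in> ?M)"
    using assms(2,3) moves_id moves_step by blast
  then have "moves_monoid \<subseteq> ?M" by (subst moves_monoid_def) (rule Inter_lower, rule CollectI)
  then show ?thesis using assms(1) by blast
qed

lemma moves_automorphism: "g \<in> moves_monoid \<Longrightarrow> automorphism g"
proof (induction rule: moves_induct)
  case (step g a b)
  then show ?case by (intro automorphism_comp move_automorphism)
qed (rule automorphism_id)

lemma move_in_moves: "a \<in> \<Omega> \<Longrightarrow> b \<in> \<Omega> \<Longrightarrow> t a b \<in> moves_monoid"
  using moves_step[OF moves_id] by simp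

lemma moves_comp: "h \<in> moves_monoid \<Longrightarrow> g \<in> moves_monoid \<Longrightarrow> h \<circ> g \<in> moves_monoid"
proof (induction rule: moves_induct)
  case (step h a b)
  then show ?case by (metis comp_assoc moves_step)
qed (metis id_comp)

lemma moves_inverse:
  assumes "g \<in> moves_monoid"
  shows "perm_inv g \<in> moves_monoid"
  using assms
proof (induction rule: moves_induct)
  case (step g a b)
  note h = step.hyps
  have "perm_inv (t a b \<circ> g) = perm_inv g \<circ> perm_inv (t a b)"
    using moves_automorphism[OF h(1)] move_automorphism[OF h(2,3)]
    unfolding automorphism_def by (intro o_inv_distrib) auto
  also have "perm_inv (t a b) = t a b" by (rule inv_unique_comp) simp_all
  finally show ?case using moves_comp[OF step.IH move_in_moves[OF h(2,3)]] by metis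
qed (metis inv_id moves_id)

lemma move_seq_snoc: "move_seq B (z # as @ [b]) = t (last (z # as)) b \<circ> move_seq B (z # as)"
  by (induction as arbitrary: z) (simp_all add: comp_assoc)

lemma move_seq_in_moves: "z \<in> \<Omega> \<Longrightarrow> set as \<subseteq> \<Omega> \<Longrightarrow> move_seq B (z # as) \<in> moves_monoid"
  by (induction as arbitrary: z) (auto intro: moves_id moves_comp move_in_moves)

text \<open>Since \<open>t x y\<close> fixes \<open>k\<close>, it conjugates \<open>t k x\<close> to
  \<open>t k y\<close>. The right-hand side is the closed walk from \<open>k\<close> through
  \<open>x\<close> and \<open>y\<close> back to \<open>k\<close>.\<close>

lemma move_conj_outside:
  assumes "noncoll x y k" "x \<in> \<Omega>" "y \<in> \<Omega>"
  shows "t x y = t y k \<circ> t x y \<circ> t k x"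
proof -
  have "t x y (t k x p) = t k y (t x y p)" for p
    using automorphism_move[OF move_automorphism[OF assms(2,3)], of k x p] move_fixes[OF assms(1)]
    by simp
  then show ?thesis by (simp add: fun_eq_iff move_commute[of y k])
qed

text \<open>A sequence ending at \<open>k\<close> can be extended to multiply by any
  \<open>t x y\<close>: by one step if \<open>k\<close> is in the support, by the walk through
  \<open>x\<close>, \<open>y\<close> and \<open>k\<close> otherwise. So the group does not depend on
  the starting point.\<close>

lemma carrier_L_inf:
  assumes "z \<in> \<Omega>" shows "carrier (L_inf \<Omega> B z) = moves_monoid"
proof
  show "carrier (L_inf \<Omega> B z) \<subseteq> moves_monoid"
    using move_seq_in_moves[OF assms] by (auto simp: L_inf_def)
  have "\<exists>as. g = move_seq B (z # as) \<and> set as \<subseteq> \<Omega>" if "g \<in> moves_monoid" for g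
    using that
  proof (induction rule: moves_induct)
    case id
    then show ?case by (intro exI[of _ "[]"]) simp
  next
    case (step g x y)
    then obtain as where as: "g = move_seq B (z # as)" "set as \<subseteq> \<Omega>" by auto
    define k where "k = last (z # as)"
    have k: "k \<in> \<Omega>" using as(2) assms last_in_set[of "z # as"] unfolding k_def by auto
    have snoc: "move_seq B (z # as @ [b]) = t k b \<circ> g" for b
      using move_seq_snoc as(1) k_def by simp
    show ?case
    proof (cases "noncoll x y k \<or> x = y")
      case False
      then have "t x y = t k (t x y k)" using move_eq_support by blast
      then show ?thesis using snoc as(2) move_in_points[OF step.hyps(2,3) k]
        by (intro exI[of _ "as @ [t x y k]"]) simp
    next
      case True
      then show ?thesis
      proof
        assume "noncoll x y k"
        have "move_seq B (z # as @ [x, y, k]) = t y k \<circ> (t x y \<circ> (t k x \<circ> g))"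
          using move_seq_snoc[of z "as @ [x, y]" k] move_seq_snoc[of z "as @ [x]" y] snoc by simp
        also have "\<dots> = t x y \<circ> g"
          using move_conj_outside[OF \<open>noncoll x y k\<close> step.hyps(2,3)] by (metis comp_assoc)
        finally have "t x y \<circ> g = move_seq B (z # as @ [x, y, k])" by (rule sym)
        moreover have "set (as @ [x, y, k]) \<subseteq> \<Omega>" using as(2) k step.hyps(2,3) by simp
        ultimately show ?thesis by blast
      next
        assume "x = y"
        then show ?thesis using as by auto
      qed
    qed
  qed
  then show "moves_monoid \<subseteq> carrier (L_inf \<Omega> B z)" by (auto simp: L_inf_def)
qed

lemma mult_L_inf [simp]: "g \<otimes>\<^bsub>L_inf \<Omega> B z\<^esub> h = h \<circ> g"
  by (simp add: L_inf_def)

lemma one_L_inf [simp]: "\<one>\<^bsub>L_inf \<Omega> B z\<^esub> = id"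
  by (simp add: L_inf_def)

lemma moves_bij: "g \<in> moves_monoid \<Longrightarrow> bij g"
  using moves_automorphism by (simp add: automorphism_def)

lemma L_inf_eq: "y \<in> \<Omega> \<Longrightarrow> z \<in> \<Omega> \<Longrightarrow> L_inf \<Omega> B y = L_inf \<Omega> B z"
  using carrier_L_inf[of y] carrier_L_inf[of z] by (simp add: L_inf_def)

lemma moves_comp_inverse:
  assumes "g \<in> moves_monoid" shows "g \<circ> perm_inv g = id" "perm_inv g \<circ> g = id"
  using moves_bij[OF assms] by (metis bij_is_surj surj_iff, metis bij_is_inj inj_iff)

lemma group_L_inf:
  assumes "z \<in> \<Omega>" shows "group (L_inf \<Omega> B z)"
  unfolding group_def group_axioms_def monoid_def Units_def mult_L_inf one_L_inf
    carrier_L_inf[OF assms]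
proof (intro conjI allI impI subsetI CollectI)
  fix g h k :: "'a \<Rightarrow> 'a"
  show "id \<in> moves_monoid" by (rule moves_id)
  show "g \<in> moves_monoid \<Longrightarrow> h \<in> moves_monoid \<Longrightarrow> h \<circ> g \<in> moves_monoid" by (rule moves_comp)
  show "k \<circ> (h \<circ> g) = k \<circ> h \<circ> g" by (rule comp_assoc[symmetric])
  show "g \<circ> id = g" "id \<circ> g = g" by (rule comp_id, rule id_comp)
  show "g \<in> moves_monoid \<Longrightarrow> g \<in> moves_monoid" .
  show "g \<in> moves_monoid \<Longrightarrow> \<exists>x\<in>moves_monoid. g \<circ> x = id \<and> x \<circ> g = id"
    using moves_inverse moves_comp_inverse by blast
qed

lemma inv_L_inf:
  assumes "z \<in> \<Omega>" "g \<in> moves_monoid"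
  shows "inv\<^bsub>L_inf \<Omega> B z\<^esub> g = perm_inv g"
proof -
  interpret group "L_inf \<Omega> B z" using group_L_inf assms(1) .
  show ?thesis
    by (rule inv_equality)
      (simp_all only: mult_L_inf one_L_inf carrier_L_inf[OF assms(1)] assms(2)
        moves_comp_inverse[OF assms(2)] moves_inverse[OF assms(2)])
qed

end

section \<open>Abelian normal subgroups\<close>

text \<open>Stated with plain composition, so that neither the base point nor the reversed product
  of \<open>L_inf\<close> enters.\<close>

locale design_abelian_normal = triangle_design +
  fixes A :: "('a \<Rightarrow> 'a) set"
  assumes A_moves: "A \<subseteq> moves_monoid"
    and A_id: "id \<in> A"
    and A_comp: "s \<in> A \<Longrightarrow> r \<in> A \<Longrightarrow> s \<circ> r \<in> A"
    and A_inv: "s \<in> A \<Longrightarrow> perm_inv s \<in> A"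
    and A_conj: "g \<in> moves_monoid \<Longrightarrow> s \<in> A \<Longrightarrow> g \<circ> s \<circ> perm_inv g \<in> A"
    and A_comm: "s \<in> A \<Longrightarrow> r \<in> A \<Longrightarrow> s \<circ> r = r \<circ> s"
    and A_nontrivial: "A \<noteq> {id}"
begin

lemma A_automorphism: "s \<in> A \<Longrightarrow> automorphism s"
  using A_moves moves_automorphism by blast

lemma A_points: "s \<in> A \<Longrightarrow> x \<in> \<Omega> \<Longrightarrow> s x \<in> \<Omega>"
  using A_automorphism automorphism_points by blast

lemma A_conj_move:
  assumes "s \<in> A" "a \<in> \<Omega>" "b \<in> \<Omega>"
  shows "t a b \<circ> s \<circ> t a b \<in> A"
proof -
  have "perm_inv (t a b) = t a b" by (rule inv_unique_comp) (rule move_comp_self)+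
  then show ?thesis using A_conj[OF move_in_moves[OF assms(2,3)] assms(1)] by metis
qed

text \<open>The product is the commutator of \<open>t x y\<close> and \<open>s\<close>, and
  \<open>A\<close> is normal. This is how products of two moves get into \<open>A\<close>.\<close>

lemma A_move_quotient:
  assumes s: "s \<in> A" and xy: "x \<in> \<Omega>" "y \<in> \<Omega>"
  shows "t x y \<circ> t (s x) (s y) \<in> A"
proof -
  have m: "s \<in> moves_monoid" using s A_moves by blast
  have "t x y \<circ> t (s x) (s y) = (t x y \<circ> s \<circ> t x y) \<circ> perm_inv s"
  proof
    fix p
    have p: "s (perm_inv s p) = p" using moves_comp_inverse(1)[OF m] by (metis comp_apply id_apply)
    show "(t x y \<circ> t (s x) (s y)) p = ((t x y \<circ> s \<circ> t x y) \<circ> perm_inv s) p"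
      using automorphism_move[OF A_automorphism[OF s], of x y "perm_inv s p"] p by simp
  qed
  then show ?thesis using A_comp A_conj_move[OF s xy] A_inv[OF s] by metis
qed

text \<open>The product permutes \<open>a, b, c\<close> cyclically; for a suitable line \<open>{a, b, x', x}\<close> it does not commute
  with its conjugate by \<open>t a x\<close>.\<close>
lemma no_product_of_order_3:
  assumes "a \<in> \<Omega>" "b \<in> \<Omega>" "c \<in> \<Omega>" "noncoll a b c"
  shows "t a c \<circ> t a b \<notin> A"
proof
  assume z: "t a c \<circ> t a b \<in> A"
  have ne: "a \<noteq> b" "a \<noteq> c" "b \<noteq> c" using assms(4) by (auto simp: noncoll_def)
  \<comment> \<open>The support of \<open>t a c\<close> contains \<open>a\<close> but not
    \<open>b\<close>, and it meets each line evenly; so of the other two points on a line through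
    \<open>a, b\<close> it misses exactly one, here \<open>x\<close>.\<close>
  obtain x' x where L: "{a, b, x', x} \<in># B" and x: "noncoll a c x"
  proof -
    obtain x y where L: "{a, b, x, y} \<in># B" using exists_line assms ne by metis
    have "\<not> noncoll a c a" "noncoll a c b" using assms(4) noncoll_swap23 by auto
    then have "noncoll a c x \<noteq> noncoll a c y" using noncoll_even_on_line[OF L assms(1,3)] by metis
    then show thesis using that L line_perms(2)[OF L] by blast
  qed
  note P = line_points[OF L] and D = line_distinct[OF L]
  have x': "x' \<noteq> a" using D by auto
  have L': "{a, x, b, x'} \<in># B" using line_perms(3)[OF line_perms(2)[OF L]] .
  have zc: "(t a c \<circ> t a b) c = a" using move_fixes[OF assms(4)] by simp
  have za: "(t a c \<circ> t a b) a = b"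
    using move_fixes[of a c b] assms(4) noncoll_swap23 by simp
  have zb: "(t a c \<circ> t a b) b = c" by simp
  have zx': "(t a c \<circ> t a b) x' = x" using move_line[OF L] move_fixes[OF x] by simp
  let ?u = "t a x"
  have w: "?u \<circ> (t a c \<circ> t a b) \<circ> ?u \<in> A" using A_conj_move[OF z, of a x] P by blast
  have uc: "?u c = c" using x noncoll_swap23 move_fixes by blast
  have ux': "?u x' = b" using move_line[OF line_perms(2)[OF L']] .
  have ub: "?u b = x'" using move_line[OF L'] .
  have wx': "(?u \<circ> (t a c \<circ> t a b) \<circ> ?u) x' = c" using ux' zb uc by simp
  have wx: "(?u \<circ> (t a c \<circ> t a b) \<circ> ?u) x = x'" using za ub by simp
  \<comment> \<open>Commutativity, evaluated at \<open>x'\<close>, gives \<open>x'\<close> on the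
    left and \<open>a\<close> on the right.\<close>
  have "(?u \<circ> (t a c \<circ> t a b) \<circ> ?u) ((t a c \<circ> t a b) x')
      = (t a c \<circ> t a b) ((?u \<circ> (t a c \<circ> t a b) \<circ> ?u) x')"
    using A_comm[OF w z] by (metis comp_apply)
  then have "x' = a" unfolding zx' wx' wx zc .
  then show False using x' by simp
qed

text \<open>Supports have equal size, so containment would be equality. The cocycle identity would
  then put all of \<open>\<Omega>\<close> into the support of \<open>t b c\<close>, against
  \<open>exists_outside_support\<close>.\<close>

lemma supports_differ:
  assumes L: "{a, b, c, d} \<in># B"
  obtains y where "y \<in> \<Omega>" "\<not> noncoll a b y" "noncoll a c y"
proof -
  note P = line_points[OF L] and D = line_distinct[OF L]
  have ne: "a \<noteq> b" "a \<noteq> c" "b \<noteq> c" using D by auto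
  have "\<exists>y\<in>\<Omega>. \<not> noncoll a b y \<and> noncoll a c y"
  proof (rule ccontr)
    assume "\<not> ?thesis"
    then have "{x \<in> \<Omega>. \<not> noncoll a b x} \<subseteq> {x \<in> \<Omega>. \<not> noncoll a c x}" by blast
    moreover have "card {x \<in> \<Omega>. \<not> noncoll a b x} = card {x \<in> \<Omega>. \<not> noncoll a c x}"
      using card_support P ne by simp
    ultimately have eq: "{x \<in> \<Omega>. \<not> noncoll a b x} = {x \<in> \<Omega>. \<not> noncoll a c x}"
      using finite_points by (intro card_subset_eq) auto
    obtain x where x: "x \<in> \<Omega>" "noncoll b c x" using exists_outside_support[of b c] P ne by metis
    have "(noncoll a b c = noncoll a b x) = (noncoll a c x = noncoll b c x)" using noncoll_cocycle P x(1) by blast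
    then show False using eq x noncoll_line[OF L] by blast
  qed
  then show thesis using that by blast
qed

text \<open>Take \<open>y\<close> in the support of \<open>t a b\<close> but not of
  \<open>t a c\<close>. The quotient of \<open>t a y\<close> by its conjugate under the product lies
  in \<open>A\<close> and has the form excluded by \<open>no_product_of_order_3\<close>.\<close>

lemma no_product_of_order_2:
  assumes L: "{a, b, c, d} \<in># B"
  shows "t a c \<circ> t a b \<notin> A"
proof
  assume s: "t a c \<circ> t a b \<in> A"
  note P = line_points[OF L] and D = line_distinct[OF L]
  have ne: "a \<noteq> b" "a \<noteq> c" "b \<noteq> c" using D by auto
  obtain y where y: "y \<in> \<Omega>" "\<not> noncoll a b y" "noncoll a c y" using supports_differ[OF L] .
  have ya: "y \<noteq> a" using y(3) by auto
  have L2: "{a, c, b, d} \<in># B" using line_perms(3)[OF L] .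
  have yb: "y \<noteq> b" using y(3) noncoll_line[OF L2] by auto
  obtain y' where M: "{a, b, y, y'} \<in># B" using noncoll_cases[OF y(2) ne(1)] ya yb by metis
  note PM = line_points[OF M] and DM = line_distinct[OF M]
  have "noncoll a c y'"
    using noncoll_even_on_line[OF M P[THEN conjunct1]] P noncoll_line[OF L2] y(3) noncoll_degenerate by metis
  then have sy: "(t a c \<circ> t a b) y = y'" using move_line[OF M] move_fixes by simp
  have sa: "(t a c \<circ> t a b) a = d" using move_line[OF L2] by simp
  have q: "t a y \<circ> t d y' \<in> A" using A_move_quotient[OF s P[THEN conjunct1] y(1)] unfolding sa sy .
  have M2: "{a, y, b, y'} \<in># B" using line_perms(3)[OF M] .
  have e1: "t a y = t y' b" using move_eq_on_line[OF M2] move_commute by metis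
  have "{b, c, a, d} \<in># B"
    using line_perms(3)[OF line_perms(1)[OF L]] .
  then have L3: "{a, d, b, c} \<in># B" by (rule line_perms)
  have "noncoll a d y = noncoll b c y" using noncoll_eq_on_line[OF L3] .
  also have "\<dots> \<longleftrightarrow> True" using noncoll_cocycle[of a b c y] P y noncoll_line[OF L] by blast
  finally have "noncoll a y d" using noncoll_swap23 by blast
  then have "noncoll y' b d" using noncoll_move_eq[OF e1] ya DM by auto
  then have n: "noncoll y' d b" using noncoll_swap23 by blast
  \<comment> \<open>Both moves are rewritten with \<open>y'\<close> as first point.\<close>
  have "t a y \<circ> t d y' = t y' b \<circ> t y' d" using e1 move_commute by metis
  then show False using q no_product_of_order_3[OF _ _ _ n] PM P by metis
qed

text \<open>Both moves can be written with the common point \<open>p\<close> first, and their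
  product lies in \<open>A\<close>. If their second points differ, these are either non-collinear
  with \<open>p\<close> or on a line with it, and one of the two exclusions applies.\<close>

lemma equal_or_disjoint_supports:
  assumes s: "s \<in> A" and xy: "x \<in> \<Omega>" "y \<in> \<Omega>" "x \<noteq> y"
    and p: "p \<in> \<Omega>" "\<not> noncoll x y p" "\<not> noncoll (s x) (s y) p"
  shows "t (s x) (s y) = t x y"
proof -
  have sxy: "s x \<noteq> s y" using automorphism_inj[OF A_automorphism[OF s]] xy by blast
  let ?q = "t x y p" and ?r = "t (s x) (s y) p"
  have e: "t x y = t p ?q" "t (s x) (s y) = t p ?r"
    using move_eq_support p xy(3) sxy by blast+
  have qr: "?q \<in> \<Omega>" "?r \<in> \<Omega>" using move_in_points p(1) xy A_points[OF s] by blast+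
  have mem: "t p ?q \<circ> t p ?r \<in> A" using A_move_quotient[OF s xy(1,2)] e by metis
  have ne: "?q \<noteq> p" "?r \<noteq> p" using move_fixed_iff p xy(3) sxy by metis+
  have nN: "\<not> noncoll p ?r ?q"
    using no_product_of_order_3[OF p(1) qr(2,1)] mem by blast
  show ?thesis
  proof (cases "?q = ?r")
    case True
    then show ?thesis using e by metis
  next
    case False
    obtain w where "{p, ?r, ?q, w} \<in># B" using noncoll_cases[OF nN] ne False by metis
    then show ?thesis using no_product_of_order_2 mem by blast
  qed
qed

text \<open>The moves \<open>t x y\<close> and its conjugate \<open>t x (s y)\<close> both move
  \<open>x\<close>, so they agree; evaluate them at \<open>x\<close>.\<close>

lemma A_semiregular:
  assumes s: "s \<in> A" and x: "x \<in> \<Omega>" "s x = x"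
  shows "s = id"
proof
  fix y
  show "s y = id y"
  proof (cases "y \<in> \<Omega> \<and> y \<noteq> x")
    case True
    have "t x (s y) = t x y"
      using equal_or_disjoint_supports[OF s x(1), of y x] True x by auto
    then show ?thesis by (metis move_left id_apply)
  next
    case False
    then show ?thesis using x A_automorphism[OF s] by (auto simp: automorphism_def)
  qed
qed

lemma A_unique:
  assumes "s \<in> A" "r \<in> A" "x \<in> \<Omega>" "s x = r x"
  shows "s = r"
proof -
  have r: "r \<in> moves_monoid" using assms A_moves by blast
  have "(perm_inv r \<circ> s) x = x"
    using assms(4) moves_comp_inverse(2)[OF r] by (metis comp_apply id_apply)
  then have "perm_inv r \<circ> s = id" using A_semiregular A_comp A_inv assms by metis
  then have "r \<circ> (perm_inv r \<circ> s) = r" by (metis comp_id)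
  then show ?thesis using moves_comp_inverse(1)[OF r] by (metis comp_assoc id_comp)
qed

text \<open>If \<open>x\<close> is not fixed, \<open>t x (s x)\<close> and its conjugate both move
  \<open>s x\<close>, hence coincide. Evaluating there gives \<open>s (s x) = x\<close>.\<close>

lemma A_involution:
  assumes s: "s \<in> A" shows "s \<circ> s = id"
proof (cases "\<exists>x\<in>\<Omega>. s x = x")
  case True
  then have "s = id" using A_semiregular[OF s] by blast
  then show ?thesis by simp
next
  case False
  have "\<Omega> \<noteq> {}" using design large by (auto simp: design_2_4_def)
  then obtain x where x: "x \<in> \<Omega>" by blast
  have ne: "x \<noteq> s x" using False x by metis
  have "t (s x) (s (s x)) = t x (s x)"
    using equal_or_disjoint_supports[OF s x A_points[OF s x] ne A_points[OF s x]] by simp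
  then have "s (s x) = x" by (metis move_left move_right)
  then show ?thesis using A_semiregular[OF A_comp[OF s s] x] by simp
qed

lemma A_involution_apply [simp]: "s \<in> A \<Longrightarrow> s (s x) = x"
  using A_involution by (metis comp_apply id_apply)

text \<open>The move \<open>t (s x) y\<close> fixes \<open>x\<close>, so conjugating
  \<open>s\<close> by it replaces the image \<open>s x\<close> of \<open>x\<close> by
  \<open>y\<close>.\<close>

lemma A_moves_further:
  assumes s: "s \<in> A" and P: "x \<in> \<Omega>" "y \<in> \<Omega>" and n: "noncoll x (s x) y"
  shows "\<exists>r\<in>A. r x = y"
proof -
  let ?u = "t (s x) y"
  have ux: "?u x = x" using n noncoll_swap12 noncoll_swap23 move_fixes by metis
  have "(?u \<circ> s \<circ> ?u) x = y" using ux by simp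
  then show ?thesis using A_conj_move[OF s A_points[OF s P(1)] P(2)] by blast
qed

text \<open>One conjugation reaches every point not collinear with \<open>x\<close> and
  \<open>s x\<close>. A collinear \<open>y\<close> needs two, through an intermediate point
  \<open>z\<close> off the supports of \<open>t x (s x)\<close> and \<open>t y x\<close>.\<close>

lemma A_transitive:
  assumes x: "x \<in> \<Omega>" and y: "y \<in> \<Omega>"
  shows "\<exists>s\<in>A. s x = y"
proof -
  obtain s where s: "s \<in> A" "s \<noteq> id" using A_nontrivial A_id by blast
  have ne: "s x \<noteq> x" using A_semiregular s x by blast
  have sx: "s x \<in> \<Omega>" using A_points s(1) x by blast
  show ?thesis
  proof (cases "noncoll x (s x) y \<or> y = x \<or> y = s x")
    case True
    then show ?thesis using A_moves_further[OF s(1) x y] A_id s(1) by (metis id_apply)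
  next
    case False
    then obtain w where L: "{x, s x, y, w} \<in># B" using noncoll_cases ne by metis
    have "{y, s x, x, w} \<in># B"
      using line_perms(3)[OF line_perms(1)[OF line_perms(3)[OF L]]] .
    then obtain z where z: "z \<in> \<Omega>" "\<not> noncoll y (s x) z" "noncoll y x z" using supports_differ by blast
    have "(noncoll x (s x) y = noncoll x (s x) z) = (noncoll x y z = noncoll (s x) y z)"
      using noncoll_cocycle[OF x sx y z(1)] .
    then have n: "noncoll x (s x) z" using noncoll_line[OF L] z(2,3) noncoll_swap12 by metis
    obtain r where r: "r \<in> A" "r x = z" using A_moves_further[OF s(1) x z(1) n] by blast
    have "noncoll x (r x) y" using r(2) z(3) noncoll_swap12 noncoll_swap23 by metis
    then show ?thesis using A_moves_further[OF r(1) x y] by blast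
  qed
qed

lemma A_bij_betw_points: "x \<in> \<Omega> \<Longrightarrow> bij_betw (\<lambda>s. s x) A \<Omega>"
  unfolding bij_betw_def
  using A_unique A_transitive A_points by (auto simp: inj_on_def image_iff) metis

end

section \<open>Symplectic spaces over the field with two elements\<close>

lemma card_Collect_less_Suc:
  "card {i. i < Suc k \<and> P i} = card {i. i < k \<and> P i} + (if P k then 1 else 0)"
proof (cases "P k")
  case True
  then have "{i. i < Suc k \<and> P i} = insert k {i. i < k \<and> P i}" by (auto simp: less_Suc_eq)
  then show ?thesis using True by simp
next
  case False
  then have "{i. i < Suc k \<and> P i} = {i. i < k \<and> P i}" by (auto simp: less_Suc_eq)
  then show ?thesis using False by simp
qed

lemma symp_form_0: "\<not> symp_form 0 S T"
  by (simp add: symp_form_def)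

lemma symp_form_Suc:
  "symp_form (Suc k) S T \<longleftrightarrow>
    (symp_form k S T \<noteq> ((2 * k \<in> S \<and> 2 * k + 1 \<in> T) \<noteq> (2 * k + 1 \<in> S \<and> 2 * k \<in> T)))"
  unfolding symp_form_def card_Collect_less_Suc by auto

lemma symp_form_cong:
  assumes "S \<inter> {..<2 * k} = S' \<inter> {..<2 * k}" "T \<inter> {..<2 * k} = T' \<inter> {..<2 * k}"
  shows "symp_form k S T = symp_form k S' T'"
proof -
  have S: "x < 2 * k \<Longrightarrow> x \<in> S \<longleftrightarrow> x \<in> S'" and T: "x < 2 * k \<Longrightarrow> x \<in> T \<longleftrightarrow> x \<in> T'" for x
    using assms by blast+
  have "{i. i < k \<and> 2 * i \<in> S \<and> 2 * i + 1 \<in> T} = {i. i < k \<and> 2 * i \<in> S' \<and> 2 * i + 1 \<in> T'}"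
    "{i. i < k \<and> 2 * i + 1 \<in> S \<and> 2 * i \<in> T} = {i. i < k \<and> 2 * i + 1 \<in> S' \<and> 2 * i \<in> T'}"
    using S T by auto
  then show ?thesis by (simp add: symp_form_def)
qed

text \<open>The coordinates \<open>2 * j\<close> and \<open>2 * j + 1\<close> are dual to each
  other, so pairing with a basis vector reads off a coordinate.\<close>

lemma symp_form_singletons:
  assumes "j < k"
  shows "symp_form k S {2 * j + 1} \<longleftrightarrow> 2 * j \<in> S" "symp_form k S {2 * j} \<longleftrightarrow> 2 * j + 1 \<in> S"
proof -
  have eqs: "{i. i < k \<and> 2 * i \<in> S \<and> 2 * i + 1 \<in> {2 * j + 1}} = (if 2 * j \<in> S then {j} else {})"
    "{i. i < k \<and> 2 * i + 1 \<in> S \<and> 2 * i \<in> {2 * j + 1}} = {}"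
    "{i. i < k \<and> 2 * i \<in> S \<and> 2 * i + 1 \<in> {2 * j}} = {}"
    "{i. i < k \<and> 2 * i + 1 \<in> S \<and> 2 * i \<in> {2 * j}} = (if 2 * j + 1 \<in> S then {j} else {})"
    using assms by (auto; presburger)+
  show "symp_form k S {2 * j + 1} \<longleftrightarrow> 2 * j \<in> S" "symp_form k S {2 * j} \<longleftrightarrow> 2 * j + 1 \<in> S"
    unfolding symp_form_def eqs by simp_all
qed

lemma symp_form_nondegenerate:
  assumes "S \<subseteq> {..<2 * k}" "\<And>T. T \<subseteq> {..<2 * k} \<Longrightarrow> \<not> symp_form k S T"
  shows "S = {}"
proof (rule ccontr)
  assume "S \<noteq> {}"
  then obtain i where i: "i \<in> S" "i < 2 * k" using assms(1) by auto
  then have j: "i div 2 < k" by simp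
  show False
  proof (cases "even i")
    case True
    then have "2 * (i div 2) = i" by simp
    then show False using symp_form_singletons(1)[OF j, of S] assms(2)[of "{2 * (i div 2) + 1}"] i j
      by auto
  next
    case False
    then have "2 * (i div 2) + 1 = i" by simp
    then show False using symp_form_singletons(2)[OF j, of S] assms(2)[of "{2 * (i div 2)}"] i j
      by auto
  qed
qed

text \<open>Over the field with two elements a vector space is just an elementary abelian 2-group;
  form values are truth values, added by \<open>\<noteq>\<close>.\<close>

locale symplectic_space =
  fixes V :: "'v set" and add :: "'v \<Rightarrow> 'v \<Rightarrow> 'v" (infixl "\<oplus>\<^sub>V" 65)
    and zero :: 'v and form :: "'v \<Rightarrow> 'v \<Rightarrow> bool"
  assumes finite_V: "finite V"
    and zero_closed: "zero \<in> V"
    and add_closed: "x \<in> V \<Longrightarrow> y \<in> V \<Longrightarrow> x \<oplus>\<^sub>V y \<in> V"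
    and add_assoc: "x \<in> V \<Longrightarrow> y \<in> V \<Longrightarrow> z \<in> V \<Longrightarrow> x \<oplus>\<^sub>V y \<oplus>\<^sub>V z = x \<oplus>\<^sub>V (y \<oplus>\<^sub>V z)"
    and add_comm: "x \<in> V \<Longrightarrow> y \<in> V \<Longrightarrow> x \<oplus>\<^sub>V y = y \<oplus>\<^sub>V x"
    and zero_add: "x \<in> V \<Longrightarrow> zero \<oplus>\<^sub>V x = x"
    and add_self: "x \<in> V \<Longrightarrow> x \<oplus>\<^sub>V x = zero"
    and form_sym: "x \<in> V \<Longrightarrow> y \<in> V \<Longrightarrow> form x y = form y x"
    and form_self: "x \<in> V \<Longrightarrow> \<not> form x x"
    and form_add: "x \<in> V \<Longrightarrow> y \<in> V \<Longrightarrow> z \<in> V \<Longrightarrow> form x (y \<oplus>\<^sub>V z) = (form x y \<noteq> form x z)"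
    and form_nondegenerate: "x \<in> V \<Longrightarrow> x \<noteq> zero \<Longrightarrow> \<exists>y\<in>V. form x y"
begin

lemma form_add_left: "x \<in> V \<Longrightarrow> y \<in> V \<Longrightarrow> z \<in> V \<Longrightarrow> form (y \<oplus>\<^sub>V z) x = (form y x \<noteq> form z x)"
  using form_add form_sym add_closed by metis

lemma form_zero: "x \<in> V \<Longrightarrow> \<not> form x zero"
  using form_add[of x zero zero] zero_closed zero_add by simp

lemma add_zero: "x \<in> V \<Longrightarrow> x \<oplus>\<^sub>V zero = x"
  using zero_add add_comm zero_closed by simp

lemma add_cancel: "x \<in> V \<Longrightarrow> y \<in> V \<Longrightarrow> x \<oplus>\<^sub>V (x \<oplus>\<^sub>V y) = y"
  using add_assoc[of x x y] add_self zero_add by simp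

lemma add_cancel_right: "x \<in> V \<Longrightarrow> y \<in> V \<Longrightarrow> x \<oplus>\<^sub>V y \<oplus>\<^sub>V y = x"
  using add_assoc[of x y y] add_self add_zero by simp

lemma add_eq_zero: "x \<in> V \<Longrightarrow> y \<in> V \<Longrightarrow> x \<oplus>\<^sub>V y = zero \<Longrightarrow> x = y"
  using add_cancel_right zero_add by metis

lemma add_left_comm:
  "x \<in> V \<Longrightarrow> y \<in> V \<Longrightarrow> z \<in> V \<Longrightarrow> x \<oplus>\<^sub>V (y \<oplus>\<^sub>V z) = y \<oplus>\<^sub>V (x \<oplus>\<^sub>V z)"
  using add_assoc add_comm by metis

section \<open>Isometries and transvections\<close>

definition isometry :: "('v \<Rightarrow> 'v) \<Rightarrow> bool" where
  "isometry g \<longleftrightarrow> bij_betw g V V \<and> (\<forall>x. x \<notin> V \<longrightarrow> g x = x) \<and>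
    (\<forall>x\<in>V. \<forall>y\<in>V. g (x \<oplus>\<^sub>V y) = g x \<oplus>\<^sub>V g y) \<and> (\<forall>x\<in>V. \<forall>y\<in>V. form (g x) (g y) = form x y)"

definition transvection :: "'v \<Rightarrow> 'v \<Rightarrow> 'v" where
  "transvection u x = (if x \<in> V \<and> form x u then x \<oplus>\<^sub>V u else x)"

lemma isometryD:
  assumes "isometry g"
  shows "x \<in> V \<Longrightarrow> g x \<in> V" "x \<notin> V \<Longrightarrow> g x = x"
    "x \<in> V \<Longrightarrow> y \<in> V \<Longrightarrow> g (x \<oplus>\<^sub>V y) = g x \<oplus>\<^sub>V g y"
    "x \<in> V \<Longrightarrow> y \<in> V \<Longrightarrow> form (g x) (g y) = form x y"
  using assms bij_betwE by (fastforce simp: isometry_def)+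

lemma isometry_comp:
  assumes "isometry g" "isometry h" shows "isometry (g \<circ> h)"
  unfolding isometry_def
proof (intro conjI ballI allI impI)
  show "bij_betw (g \<circ> h) V V" using assms bij_betw_trans unfolding isometry_def by blast
qed (simp_all add: isometryD[OF assms(1)] isometryD[OF assms(2)])

lemma transvection_closed: "u \<in> V \<Longrightarrow> x \<in> V \<Longrightarrow> transvection u x \<in> V"
  by (simp add: transvection_def add_closed)

lemma transvection_involutive: "u \<in> V \<Longrightarrow> transvection u (transvection u x) = x"
  by (cases "x \<in> V \<and> form x u")
    (auto simp: transvection_def add_closed add_cancel_right form_add_left form_self)

lemma transvection_isometry:
  assumes u: "u \<in> V" shows "isometry (transvection u)"
  unfolding isometry_def
proof (intro conjI ballI allI impI)
  show "bij_betw (transvection u) V V"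
    using transvection_involutive[OF u] transvection_closed[OF u]
    by (intro bij_betw_byWitness[where f' = "transvection u"]) auto
next
  fix x y assume xy: "x \<in> V" "y \<in> V"
  have "x \<oplus>\<^sub>V u \<oplus>\<^sub>V (y \<oplus>\<^sub>V u) = x \<oplus>\<^sub>V (u \<oplus>\<^sub>V (u \<oplus>\<^sub>V y))"
    using xy u by (simp add: add_assoc add_closed add_comm[of y u])
  then have "x \<oplus>\<^sub>V u \<oplus>\<^sub>V (y \<oplus>\<^sub>V u) = x \<oplus>\<^sub>V y" using xy u by (simp add: add_cancel)
  moreover have "x \<oplus>\<^sub>V y \<oplus>\<^sub>V u = x \<oplus>\<^sub>V (y \<oplus>\<^sub>V u)" using xy u by (simp add: add_assoc)
  moreover have "x \<oplus>\<^sub>V y \<oplus>\<^sub>V u = x \<oplus>\<^sub>V u \<oplus>\<^sub>V y"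
    using xy u by (simp add: add_assoc add_comm[of y u])
  ultimately show "transvection u (x \<oplus>\<^sub>V y) = transvection u x \<oplus>\<^sub>V transvection u y"
    using xy u by (auto simp: transvection_def add_closed form_add_left)
  show "form (transvection u x) (transvection u y) = form x y"
    using xy u form_sym[of u x] form_sym[of u y]
    by (auto simp: transvection_def add_closed form_add_left form_add form_self)
qed (simp add: transvection_def)

definition moved :: "('v \<Rightarrow> 'v) \<Rightarrow> 'v set" where
  "moved g = {x \<in> V. g x \<noteq> x}"

text \<open>As \<open>g\<close> preserves the form, a fixed \<open>x\<close> pairs equally with
  \<open>g v\<close> and \<open>v\<close>, so it is orthogonal to the direction of the
  transvection.\<close>

lemma transvection_keeps_fixed:
  assumes g: "isometry g" and v: "v \<in> V" and x: "x \<in> V" "g x = x"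
  shows "(transvection (g v \<oplus>\<^sub>V v) \<circ> g) x = x"
proof -
  have gv: "g v \<in> V" using isometryD[OF g] v by blast
  have "form x (g v) = form x v" using isometryD(4)[OF g x(1) v] x(2) by simp
  then show ?thesis using x v gv form_add by (simp add: transvection_def)
qed

text \<open>\<open>g v\<close> is not orthogonal to the direction, so the transvection takes it back
  to \<open>v\<close>; vectors fixed before stay fixed.\<close>

lemma transvection_fixes_more:
  assumes g: "isometry g" and v: "v \<in> V" "form v (g v)"
  shows "moved (transvection (g v \<oplus>\<^sub>V v) \<circ> g) \<subset> moved g"
proof -
  have gv: "g v \<in> V" using isometryD[OF g] v by blast
  have "(transvection (g v \<oplus>\<^sub>V v) \<circ> g) v = g v \<oplus>\<^sub>V (g v \<oplus>\<^sub>V v)"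
    using v gv form_sym[of v "g v"] by (simp add: transvection_def form_add form_self)
  then have "(transvection (g v \<oplus>\<^sub>V v) \<circ> g) v = v" using v gv by (simp add: add_cancel)
  moreover have "g v \<noteq> v" using v form_self by metis
  ultimately have "v \<in> moved g" "v \<notin> moved (transvection (g v \<oplus>\<^sub>V v) \<circ> g)"
    using v by (auto simp: moved_def)
  moreover have "moved (transvection (g v \<oplus>\<^sub>V v) \<circ> g) \<subseteq> moved g"
    using transvection_keeps_fixed[OF g v(1)] unfolding moved_def by blast
  ultimately show ?thesis by blast
qed

text \<open>If \<open>form v (g v)\<close> vanishes identically, one auxiliary transvection, which moves no fixed
  vector of \<open>g\<close>, destroys this.\<close>
lemma transvection_breaks_isotropy:
  assumes g: "isometry g" and isotropic: "\<And>v. v \<in> V \<Longrightarrow> \<not> form v (g v)"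
    and v: "v \<in> V" "g v \<noteq> v"
  shows "\<exists>y\<in>V. form y ((transvection (g v \<oplus>\<^sub>V v) \<circ> g) y)"
proof -
  note gc = isometryD(1)[OF g]
  let ?u = "g v \<oplus>\<^sub>V v"
  have u: "?u \<in> V" "?u \<noteq> zero" using v gc add_closed add_eq_zero by blast+
  obtain y where y: "y \<in> V" "form ?u y" using form_nondegenerate[OF u] by blast
  have yu: "form y ?u" using form_sym y u by blast
  \<comment> \<open>Polarization: isotropy at \<open>v\<close>, at \<open>y\<close> and at their sum
    makes the two mixed terms equal.\<close>
  have "\<not> form (v \<oplus>\<^sub>V y) (g v \<oplus>\<^sub>V g y)"
    using isotropic[of "v \<oplus>\<^sub>V y"] isometryD(3)[OF g v(1) y(1)] v y add_closed by simp
  then have "form v (g y) = form y (g v)"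
    using isotropic[OF v(1)] isotropic[OF y(1)] v y gc by (simp add: form_add form_add_left add_closed)
  then have "form (g y) v = form y (g v)" using form_sym v y gc by metis
  then have "form (g y) ?u = form y ?u"
    using isometryD(4)[OF g y(1) v(1)] v y gc by (auto simp: form_add)
  then have "(transvection ?u \<circ> g) y = g y \<oplus>\<^sub>V ?u" using yu y gc by (simp add: transvection_def)
  then have "form y ((transvection ?u \<circ> g) y)"
    using yu isotropic[OF y(1)] form_add[of y "g y" ?u] y gc u by simp
  then show ?thesis using y by blast
qed

text \<open>Multiplying by transvections enlarges the set of fixed vectors step by step.\<close>
lemma transvections_generate:
  assumes "isometry g" and "id \<in> H"
    and "\<And>u h. u \<in> V \<Longrightarrow> h \<in> H \<Longrightarrow> transvection u \<circ> h \<in> H"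
  shows "g \<in> H"
  using assms(1)
proof (induction "card (moved g)" arbitrary: g rule: less_induct)
  case less
  note g = less.prems
  note gc = isometryD(1)[OF g]
  have fin: "finite (moved h)" for h using finite_V by (simp add: moved_def)
  have undo: "h \<in> H" if "u \<in> V" "transvection u \<circ> h \<in> H" for u h
  proof -
    have "transvection u \<circ> (transvection u \<circ> h) = h"
      using transvection_involutive[OF that(1)] by (simp add: fun_eq_iff)
    then show ?thesis using assms(3)[OF that] by metis
  qed
  show ?case
  proof (cases "\<exists>v\<in>V. form v (g v)")
    case True
    then obtain v where v: "v \<in> V" "form v (g v)" by blast
    have "transvection (g v \<oplus>\<^sub>V v) \<circ> g \<in> H"
      using less.hyps[OF psubset_card_mono[OF fin transvection_fixes_more[OF g v]]]
        isometry_comp[OF transvection_isometry g] v(1) gc add_closed by blast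
    then show ?thesis using undo v(1) gc add_closed by blast
  next
    case iso: False
    show ?thesis
    proof (cases "moved g = {}")
      case True
      have "g = id"
      proof
        fix x show "g x = id x" using True isometryD(2)[OF g] by (cases "x \<in> V") (auto simp: moved_def)
      qed
      then show ?thesis using assms(2) by simp
    next
      case False
      then obtain v where v: "v \<in> V" "g v \<noteq> v" by (auto simp: moved_def)
      let ?u = "g v \<oplus>\<^sub>V v"
      let ?g = "transvection ?u \<circ> g"
      have u: "?u \<in> V" using v gc add_closed by blast
      have g1: "isometry ?g" using isometry_comp[OF transvection_isometry[OF u] g] .
      have sub: "moved ?g \<subseteq> moved g"
        using transvection_keeps_fixed[OF g v(1)] unfolding moved_def by blast
      obtain y where y: "y \<in> V" "form y (?g y)"
        using transvection_breaks_isotropy[OF g _ v] iso by blast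
      have w: "?g y \<oplus>\<^sub>V y \<in> V" using isometryD(1)[OF g1] y(1) add_closed by blast
      \<comment> \<open>The auxiliary transvection loses no fixed vector and the next one gains
        \<open>y\<close>, so the induction hypothesis applies to the twofold product.\<close>
      have "moved (transvection (?g y \<oplus>\<^sub>V y) \<circ> ?g) \<subset> moved g"
        using transvection_fixes_more[OF g1 y] sub by blast
      then have "transvection (?g y \<oplus>\<^sub>V y) \<circ> ?g \<in> H"
        using less.hyps[OF psubset_card_mono[OF fin]] isometry_comp[OF transvection_isometry[OF w] g1]
        by blast
      then show ?thesis using undo w u by blast
    qed
  qed
qed

text \<open>The last clause, that every functional on the image is represented by a coordinate vector, is
  carried along so that projections onto the orthogonal complement are available when extending.\<close>
definition embedding :: "nat \<Rightarrow> (nat set \<Rightarrow> 'v) \<Rightarrow> bool" where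
  "embedding k h \<longleftrightarrow> (\<forall>S\<in>sp_vecs k. h S \<in> V) \<and>
    (\<forall>S\<in>sp_vecs k. \<forall>T\<in>sp_vecs k. h (vadd S T) = h S \<oplus>\<^sub>V h T) \<and>
    (\<forall>S\<in>sp_vecs k. \<forall>T\<in>sp_vecs k. form (h S) (h T) = symp_form k S T) \<and>
    (\<forall>v\<in>V. \<exists>S\<in>sp_vecs k. \<forall>T\<in>sp_vecs k. form v (h T) = symp_form k S T)"

text \<open>A coordinate vector sent to \<open>zero\<close> pairs trivially with all others, so
  nondegeneracy of \<open>symp_form\<close> makes it empty.\<close>

lemma embedding_inj:
  assumes "embedding k h" shows "inj_on h (sp_vecs k)"
proof (rule inj_onI)
  fix S T assume ST: "S \<in> sp_vecs k" "T \<in> sp_vecs k" "h S = h T"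
  have D: "vadd S T \<in> sp_vecs k" using ST by (auto simp: sp_vecs_def vadd_def)
  have z: "h (vadd S T) = zero" using assms ST add_self by (simp add: embedding_def)
  have "\<not> symp_form k (vadd S T) R" if R: "R \<in> sp_vecs k" for R
  proof -
    have "h R \<in> V" "form (h (vadd S T)) (h R) = symp_form k (vadd S T) R"
      using assms D R unfolding embedding_def by blast+
    then show ?thesis using z form_zero[of "h R"] form_sym[of zero "h R"] zero_closed by simp
  qed
  then have "vadd S T = {}" using symp_form_nondegenerate[of "vadd S T" k] D by (simp add: sp_vecs_def)
  then show "S = T" by (auto simp: vadd_def)
qed

lemma embedding_0: "embedding 0 (\<lambda>_. zero)"
  using zero_closed zero_add form_zero
  by (auto simp: embedding_def sp_vecs_def symp_form_0)

text \<open>Orthogonal projection: add the image of the coordinate vector that represents the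
  functional of \<open>v\<close>.\<close>

lemma embedding_complement:
  assumes h: "embedding k h" and v: "v \<in> V"
  shows "\<exists>S\<in>sp_vecs k. \<forall>T\<in>sp_vecs k. \<not> form (v \<oplus>\<^sub>V h S) (h T)"
proof -
  obtain S where S: "S \<in> sp_vecs k" "\<forall>T\<in>sp_vecs k. form v (h T) = symp_form k S T"
    using h v unfolding embedding_def by blast
  have "\<not> form (v \<oplus>\<^sub>V h S) (h T)" if T: "T \<in> sp_vecs k" for T
  proof -
    have "h S \<in> V" "h T \<in> V" "form (h S) (h T) = symp_form k S T"
      using h S(1) T unfolding embedding_def by blast+
    then show ?thesis using S(2) T v by (simp add: form_add_left)
  qed
  then show ?thesis using S(1) by blast
qed

text \<open>The hyperbolic pair \<open>e, f\<close>, orthogonal to the image, becomes the image of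
  the new basis vectors \<open>2 * k\<close> and \<open>2 * k + 1\<close>.\<close>

lemma embedding_Suc:
  assumes h: "embedding k h" and ef: "e \<in> V" "f \<in> V" "form e f"
    and e: "\<And>T. T \<in> sp_vecs k \<Longrightarrow> \<not> form e (h T)"
    and f: "\<And>T. T \<in> sp_vecs k \<Longrightarrow> \<not> form f (h T)"
  shows "\<exists>h'. embedding (Suc k) h'"
proof -
  let ?r = "\<lambda>S. S \<inter> {..<2 * k}"
  let ?e = "\<lambda>S. if 2 * k \<in> S then e else zero"
  let ?f = "\<lambda>S. if 2 * k + 1 \<in> S then f else zero"
  define h' where "h' = (\<lambda>S. h (?r S) \<oplus>\<^sub>V (?e S \<oplus>\<^sub>V ?f S))"
  have r: "?r S \<in> sp_vecs k" for S by (auto simp: sp_vecs_def)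
  have hV: "h (?r S) \<in> V" for S using h r unfolding embedding_def by blast
  have eV: "?e S \<in> V" and fV: "?f S \<in> V" for S using ef zero_closed by auto
  have h'V: "h' S \<in> V" for S unfolding h'_def using hV eV fV add_closed by blast
  have form_r: "symp_form k (?r S) (?r T) = symp_form k S T" for S T
    by (rule symp_form_cong) auto
  have addh: "h (?r (vadd S T)) = h (?r S) \<oplus>\<^sub>V h (?r T)" for S T
  proof -
    have "?r (vadd S T) = vadd (?r S) (?r T)" by (auto simp: vadd_def)
    then show ?thesis using h r unfolding embedding_def by metis
  qed
  have adde: "?e (vadd S T) = ?e S \<oplus>\<^sub>V ?e T" "?f (vadd S T) = ?f S \<oplus>\<^sub>V ?f T" for S T
    using ef zero_closed by (auto simp: vadd_def zero_add add_zero add_self)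
  have four: "a \<oplus>\<^sub>V a' \<oplus>\<^sub>V (b \<oplus>\<^sub>V b') = a \<oplus>\<^sub>V b \<oplus>\<^sub>V (a' \<oplus>\<^sub>V b')"
    if "a \<in> V" "a' \<in> V" "b \<in> V" "b' \<in> V" for a a' b b'
  proof -
    have "a' \<oplus>\<^sub>V (b \<oplus>\<^sub>V b') = b \<oplus>\<^sub>V (a' \<oplus>\<^sub>V b')" using add_left_comm that by blast
    then show ?thesis using that by (simp only: add_assoc add_closed)
  qed
  have add: "h' (vadd S T) = h' S \<oplus>\<^sub>V h' T" for S T
  proof -
    have "h' (vadd S T) = h (?r S) \<oplus>\<^sub>V h (?r T) \<oplus>\<^sub>V (?e S \<oplus>\<^sub>V ?e T \<oplus>\<^sub>V (?f S \<oplus>\<^sub>V ?f T))"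
      by (simp only: h'_def addh adde)
    also have "\<dots> = h (?r S) \<oplus>\<^sub>V h (?r T) \<oplus>\<^sub>V (?e S \<oplus>\<^sub>V ?f S \<oplus>\<^sub>V (?e T \<oplus>\<^sub>V ?f T))"
      using four[OF eV eV fV fV, of S T S T] by (rule arg_cong)
    also have "\<dots> = h' S \<oplus>\<^sub>V h' T"
      unfolding h'_def by (rule four[OF hV hV add_closed[OF eV fV] add_closed[OF eV fV]])
    finally show ?thesis .
  qed
  have v_h': "form v (h' T) = (form v (h (?r T)) \<noteq> ((2 * k \<in> T \<and> form v e) \<noteq> (2 * k + 1 \<in> T \<and> form v f)))"
    if "v \<in> V" for v T
  proof -
    have "form v (?e T) \<longleftrightarrow> 2 * k \<in> T \<and> form v e" "form v (?f T) \<longleftrightarrow> 2 * k + 1 \<in> T \<and> form v f"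
      using form_zero[OF that] by auto
    then show ?thesis
      unfolding h'_def using form_add[OF that hV add_closed[OF eV fV]] form_add[OF that eV fV] by metis
  qed
  have ee: "form e (h' T) \<longleftrightarrow> 2 * k + 1 \<in> T" for T
    using v_h'[OF ef(1)] e[OF r] form_self[OF ef(1)] ef(3) by blast
  have ff: "form f (h' T) \<longleftrightarrow> 2 * k \<in> T" for T
    using v_h'[OF ef(2)] f[OF r] form_self[OF ef(2)] form_sym[OF ef(1,2)] ef(3) by blast
  have hh: "form (h (?r S)) (h' T) = symp_form k S T" for S T
  proof -
    have "\<not> form (h (?r S)) e" "\<not> form (h (?r S)) f" using e f r ef form_sym hV by blast+
    moreover have "form (h (?r S)) (h (?r T)) = symp_form k S T"
      using h r form_r unfolding embedding_def by metis
    ultimately show ?thesis using v_h'[OF hV] by blast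
  qed
  have form: "form (h' S) (h' T) = symp_form (Suc k) S T" for S T
  proof -
    have "form (h' S) (h' T) = (form (h (?r S)) (h' T) \<noteq> (form (?e S) (h' T) \<noteq> form (?f S) (h' T)))"
    proof -
      have "form (h' S) (h' T) = form (h (?r S) \<oplus>\<^sub>V (?e S \<oplus>\<^sub>V ?f S)) (h' T)"
        by (simp only: h'_def)
      then show ?thesis
        using form_add_left[OF h'V hV add_closed[OF eV fV]] form_add_left[OF h'V eV fV] by simp
    qed
    moreover have "form (?e S) (h' T) \<longleftrightarrow> 2 * k \<in> S \<and> 2 * k + 1 \<in> T"
      using ee[of T] form_zero[OF h'V, of T] form_sym[OF zero_closed h'V, of T] by simp
    moreover have "form (?f S) (h' T) \<longleftrightarrow> 2 * k + 1 \<in> S \<and> 2 * k \<in> T"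
      using ff[of T] form_zero[OF h'V, of T] form_sym[OF zero_closed h'V, of T] by simp
    ultimately show ?thesis using hh symp_form_Suc by presburger
  qed
  have riesz: "\<exists>S\<in>sp_vecs (Suc k). \<forall>T\<in>sp_vecs (Suc k). form v (h' T) = symp_form (Suc k) S T"
    if v: "v \<in> V" for v
  proof -
    obtain S where S: "S \<in> sp_vecs k" "\<forall>T\<in>sp_vecs k. form v (h T) = symp_form k S T"
      using h v unfolding embedding_def by blast
    \<comment> \<open>The coordinates are crossed because \<open>symp_form\<close> pairs
      \<open>2 * k\<close> with \<open>2 * k + 1\<close>.\<close>
    define S' where "S' = S \<union> (if form v f then {2 * k} else {}) \<union> (if form v e then {2 * k + 1} else {})"
    have m: "2 * k \<in> S' \<longleftrightarrow> form v f" "2 * k + 1 \<in> S' \<longleftrightarrow> form v e"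
      using S(1) by (auto simp: S'_def sp_vecs_def)
    have "S' \<in> sp_vecs (Suc k)" using S(1) by (auto simp: S'_def sp_vecs_def)
    moreover have "form v (h' T) = symp_form (Suc k) S' T" for T
    proof -
      have "symp_form k S' T = symp_form k S (?r T)"
        by (rule symp_form_cong) (use S(1) in \<open>auto simp: S'_def sp_vecs_def\<close>)
      also have "\<dots> = form v (h (?r T))" using S(2) r by blast
      finally show ?thesis unfolding symp_form_Suc v_h'[OF v] m by (rule ssubst) blast
    qed
    ultimately show ?thesis by blast
  qed
  have "embedding (Suc k) h'"
    unfolding embedding_def by (intro conjI ballI h'V add form riesz)
  then show ?thesis by blast
qed

text \<open>Gram-Schmidt: a vector outside the image projects to a nonzero \<open>e\<close>
  orthogonal to the image. Nondegeneracy gives a partner, whose projection still pairs non-trivially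
  with \<open>e\<close>.\<close>

lemma embedding_extend:
  assumes h: "embedding k h" and ne: "h ` sp_vecs k \<noteq> V"
  shows "\<exists>h'. embedding (Suc k) h'"
proof -
  have hV: "S \<in> sp_vecs k \<Longrightarrow> h S \<in> V" for S using h unfolding embedding_def by blast
  then obtain v where v: "v \<in> V" "v \<notin> h ` sp_vecs k" using ne by blast
  obtain S where S: "S \<in> sp_vecs k" "\<forall>T\<in>sp_vecs k. \<not> form (v \<oplus>\<^sub>V h S) (h T)"
    using embedding_complement[OF h v(1)] by blast
  let ?e = "v \<oplus>\<^sub>V h S"
  have e: "?e \<in> V" "?e \<noteq> zero" using v S(1) hV add_closed add_eq_zero by blast+
  obtain w where w: "w \<in> V" "form ?e w" using form_nondegenerate[OF e] by blast
  obtain R where R: "R \<in> sp_vecs k" "\<forall>T\<in>sp_vecs k. \<not> form (w \<oplus>\<^sub>V h R) (h T)"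
    using embedding_complement[OF h w(1)] by blast
  have "form ?e (w \<oplus>\<^sub>V h R)" using form_add[OF e(1) w(1) hV[OF R(1)]] w(2) S(2) R(1) by blast
  then show ?thesis
    using embedding_Suc[OF h e(1) add_closed[OF w(1) hV[OF R(1)]]] S(2) R(2) by blast
qed

lemma card_sp_vecs: "card (sp_vecs k) = 2 ^ (2 * k)"
  by (simp add: sp_vecs_def card_Pow)

text \<open>If no embedding were onto, each could be extended by two dimensions, and some embedding
  would outgrow the finite \<open>V\<close>.\<close>

lemma standard_coordinates: "\<exists>m h. embedding m h \<and> bij_betw h (sp_vecs m) V"
proof (rule ccontr)
  assume "\<not> ?thesis"
  then have "h ` sp_vecs k \<noteq> V" if "embedding k h" for k h
    using embedding_inj[OF that] that unfolding bij_betw_def by blast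
  then have "\<exists>h. embedding k h" for k
    by (induction k) (use embedding_0 embedding_extend in blast)+
  then obtain h where h: "embedding (card V) h" by blast
  have "card (h ` sp_vecs (card V)) \<le> card V"
    using h finite_V unfolding embedding_def by (intro card_mono) auto
  then have "2 ^ (2 * card V) \<le> card V"
    using card_image[OF embedding_inj[OF h]] card_sp_vecs by simp
  moreover have "card V < 2 ^ card V" by (rule less_exp)
  moreover have "(2::nat) ^ card V \<le> 2 ^ (2 * card V)" by (rule power_increasing) auto
  ultimately show False by linarith
qed

lemma isometries_Sp2:
  obtains m \<Psi> where "card V = 2 ^ (2 * m)" "bij_betw \<Psi> {g. isometry g} (carrier (Sp2 m))"
    "\<And>g g'. isometry g \<Longrightarrow> isometry g' \<Longrightarrow> \<Psi> (g \<circ> g') = \<Psi> g \<otimes>\<^bsub>Sp2 m\<^esub> \<Psi> g'"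
proof -
  obtain m h where h: "embedding m h" "bij_betw h (sp_vecs m) V" using standard_coordinates by blast
  let ?P = "sp_vecs m"
  define k where "k = inv_into ?P h"
  have hV: "S \<in> ?P \<Longrightarrow> h S \<in> V" for S using h(1) unfolding embedding_def by blast
  have kP: "x \<in> V \<Longrightarrow> k x \<in> ?P" and hk: "x \<in> V \<Longrightarrow> h (k x) = x" and kh: "S \<in> ?P \<Longrightarrow> k (h S) = S" for x S
    using h(2) unfolding k_def
    by (auto simp: bij_betw_def inv_into_into f_inv_into_f inv_into_f_f)
  have vP: "S \<in> ?P \<Longrightarrow> T \<in> ?P \<Longrightarrow> vadd S T \<in> ?P" for S T by (auto simp: sp_vecs_def vadd_def)
  have hadd: "S \<in> ?P \<Longrightarrow> T \<in> ?P \<Longrightarrow> h (vadd S T) = h S \<oplus>\<^sub>V h T" for S T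
    using h(1) unfolding embedding_def by blast
  have hform: "S \<in> ?P \<Longrightarrow> T \<in> ?P \<Longrightarrow> form (h S) (h T) = symp_form m S T" for S T
    using h(1) unfolding embedding_def by blast
  have kadd: "k (x \<oplus>\<^sub>V y) = vadd (k x) (k y)" if "x \<in> V" "y \<in> V" for x y
    using hadd[OF kP kP, OF that] hk that kh[OF vP[OF kP kP, OF that]] by simp
  have kform: "symp_form m (k x) (k y) = form x y" if "x \<in> V" "y \<in> V" for x y
    using hform[OF kP kP, OF that] hk that by simp
  have bk: "bij_betw k V ?P" unfolding k_def using h(2) by (rule bij_betw_inv_into)
  \<comment> \<open>Elements of \<open>Sp2\<close> are \<open>undefined\<close> off the coordinate
    space, isometries are the identity off \<open>V\<close>; hence the restriction one way and the
    case distinction the other way.\<close>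
  define \<Psi> where "\<Psi> = (\<lambda>g. restrict (\<lambda>S. k (g (h S))) ?P)"
  define \<Theta> where "\<Theta> = (\<lambda>\<sigma> x. if x \<in> V then h (\<sigma> (k x)) else x)"
  have 1: "\<Psi> g \<in> carrier (Sp2 m)" if g: "isometry g" for g
  proof -
    have "bij_betw (k \<circ> (g \<circ> h)) ?P ?P"
      using g bij_betw_trans[OF bij_betw_trans[OF h(2)] bk] unfolding isometry_def by blast
    then have "bij_betw (\<Psi> g) ?P ?P"
      by (rule bij_betw_cong[THEN iffD1, rotated]) (simp add: \<Psi>_def)
    moreover have "\<Psi> g \<in> extensional ?P" by (simp add: \<Psi>_def)
    ultimately show ?thesis
      by (simp add: Sp2_def \<Psi>_def vP hadd isometryD[OF g] hV kadd kform hform)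
  qed
  have 2: "isometry (\<Theta> \<sigma>)" and 3: "\<Psi> (\<Theta> \<sigma>) = \<sigma>" if s: "\<sigma> \<in> carrier (Sp2 m)" for \<sigma>
  proof -
    have b: "bij_betw \<sigma> ?P ?P" and ext: "\<sigma> \<in> extensional ?P"
      and sadd: "S \<in> ?P \<Longrightarrow> T \<in> ?P \<Longrightarrow> \<sigma> (vadd S T) = vadd (\<sigma> S) (\<sigma> T)"
      and sform: "S \<in> ?P \<Longrightarrow> T \<in> ?P \<Longrightarrow> symp_form m (\<sigma> S) (\<sigma> T) = symp_form m S T" for S T
      using s by (auto simp: Sp2_def)
    have sP: "S \<in> ?P \<Longrightarrow> \<sigma> S \<in> ?P" for S using b bij_betwE by blast
    have "bij_betw (h \<circ> (\<sigma> \<circ> k)) V V" using bij_betw_trans[OF bij_betw_trans[OF bk b] h(2)] .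
    then have "bij_betw (\<Theta> \<sigma>) V V"
      by (rule bij_betw_cong[THEN iffD1, rotated]) (simp add: \<Theta>_def)
    then show "isometry (\<Theta> \<sigma>)"
      by (simp add: isometry_def \<Theta>_def add_closed kadd kP sadd hadd sP hform sform kform)
    show "\<Psi> (\<Theta> \<sigma>) = \<sigma>"
      by (rule extensionalityI[OF _ ext]) (simp_all add: \<Psi>_def \<Theta>_def hV kh sP)
  qed
  have 4: "\<Theta> (\<Psi> g) = g" if g: "isometry g" for g
    using isometryD(1,2)[OF g] kP hk by (auto simp: \<Theta>_def \<Psi>_def)
  have bij: "bij_betw \<Psi> {g. isometry g} (carrier (Sp2 m))"
    by (rule bij_betw_byWitness[where f' = \<Theta>]) (use 1 2 3 4 in auto)
  have mult: "\<Psi> (g \<circ> g') = \<Psi> g \<otimes>\<^bsub>Sp2 m\<^esub> \<Psi> g'" if "isometry g" "isometry g'" for g g'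
  proof -
    have "\<Psi> g \<otimes>\<^bsub>Sp2 m\<^esub> \<Psi> g' = restrict (\<lambda>S. \<Psi> g (\<Psi> g' S)) ?P"
      by (simp add: Sp2_def compose_def)
    also have "\<dots> = \<Psi> (g \<circ> g')"
      unfolding \<Psi>_def
      by (rule restrict_ext) (use isometryD(1)[OF that(2)] hV hk kP in simp)
    finally show ?thesis by (rule sym)
  qed
  show thesis
    by (rule that[OF _ bij mult]) (use bij_betw_same_card[OF h(2)] card_sp_vecs in simp)
qed

end

section \<open>The affine structure\<close>

locale affine_design = design_abelian_normal +
  fixes z :: 'a
  assumes base: "z \<in> \<Omega>"
begin

text \<open>Regularity of \<open>A\<close> makes this element unique. Applied to a second point it
  serves as vector addition with origin \<open>z\<close>.\<close>

definition translation :: "'a \<Rightarrow> 'a \<Rightarrow> 'a" where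
  "translation x = (THE s. s \<in> A \<and> s z = x)"

lemma translation_eq: "s \<in> A \<Longrightarrow> translation (s z) = s"
  unfolding translation_def using A_unique base by (intro the_equality) blast+

lemma translation_in_A: "x \<in> \<Omega> \<Longrightarrow> translation x \<in> A"
  using A_transitive[OF base] translation_eq by metis

lemma translation_base: "x \<in> \<Omega> \<Longrightarrow> translation x z = x"
  using A_transitive[OF base] translation_eq by metis

lemma translation_of_base: "translation z = id"
  using translation_eq[OF A_id] by simp

lemma noncoll_tr: "r \<in> \<Omega> \<Longrightarrow> noncoll (translation r a) (translation r b) (translation r c) = noncoll a b c"
  using automorphism_noncoll A_automorphism translation_in_A by blast

text \<open>\<open>r\<close> is the image of \<open>z\<close> under its translation, so it lies in
  the support of the translated move. It also lies in that of \<open>t z s\<close>, so the two moves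
  agree.\<close>

lemma noncoll_tr_collinear:
  assumes "s \<in> \<Omega>" "s \<noteq> z" "r \<in> \<Omega>" "\<not> noncoll z s r"
  shows "noncoll r (translation r s) x = noncoll z s x"
proof -
  have r: "translation r z = r" using translation_base assms by blast
  have rA: "translation r \<in> A" using translation_in_A assms by blast
  have ne: "r \<noteq> translation r s"
    using automorphism_inj[OF A_automorphism[OF rA], of z s] assms(2) r by simp
  have "t (translation r z) (translation r s) = t z s"
    using equal_or_disjoint_supports[OF rA base assms(1) _ assms(3,4)] assms(2) r by simp
  then have "t r (translation r s) = t z s" unfolding r .
  then show ?thesis using noncoll_move_eq ne assms(2) by blast
qed

text \<open>\<open>r\<close> lies in only one of the two supports, so they are disjoint. The product
  of the moves lies in \<open>A\<close> and takes \<open>z\<close> to \<open>s\<close>; having no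
  fixed point, it forces the supports to cover \<open>\<Omega>\<close>.\<close>

lemma translation_product:
  assumes "s \<in> \<Omega>" "r \<in> \<Omega>" "noncoll z s r"
  shows "translation s = t z s \<circ> t r (translation r s)" and "x \<in> \<Omega> \<Longrightarrow> noncoll r (translation r s) x \<noteq> noncoll z s x"
proof -
  have sz: "s \<noteq> z" using assms(3) by auto
  have r: "translation r z = r" using translation_base assms by blast
  have rA: "translation r \<in> A" using translation_in_A assms by blast
  have ne: "r \<noteq> translation r s" using automorphism_inj[OF A_automorphism[OF rA], of z s] sz r by simp
  have disj: "noncoll z s x \<or> noncoll r (translation r s) x" if "x \<in> \<Omega>" for x
  proof (rule ccontr)
    assume "\<not> ?thesis"
    then have "t (translation r z) (translation r s) = t z s"
      using equal_or_disjoint_supports[OF rA base assms(1)] sz that r by auto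
    then have "noncoll r (translation r s) r = noncoll z s r"
      using noncoll_move_eq[of r "translation r s" z s r] sz ne unfolding r by blast
    then show False using assms(3) noncoll_degenerate(2) by blast
  qed
  have "t z s \<circ> t (translation r z) (translation r s) \<in> A" using A_move_quotient[OF rA base assms(1)] .
  then have m: "t z s \<circ> t r (translation r s) \<in> A" using r by simp
  have "noncoll r (translation r s) z" using disj[OF base] by simp
  then have "t r (translation r s) z = z" by (rule move_fixes)
  then have "(t z s \<circ> t r (translation r s)) z = s" by simp
  then show eq: "translation s = t z s \<circ> t r (translation r s)" using translation_eq[OF m] by metis
  show "noncoll r (translation r s) x \<noteq> noncoll z s x" if x: "x \<in> \<Omega>"
  proof
    assume "noncoll r (translation r s) x = noncoll z s x"
    then have "noncoll r (translation r s) x" "noncoll z s x" using disj[OF x] by auto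
    then have "t r (translation r s) x = x" "t z s x = x" by (blast intro: move_fixes)+
    then have "translation s x = x" unfolding eq by simp
    then have "translation s = id" using A_semiregular translation_in_A assms(1) x by blast
    then show False using translation_base[OF assms(1)] sz by simp
  qed
qed

text \<open>Translation by \<open>r\<close> carries the support of \<open>t z s\<close> to that of
  \<open>t r (translation r s)\<close>, which is the same set or its complement according to
  \<open>noncoll z s r\<close>.\<close>

lemma noncoll_additive:
  assumes s: "s \<in> \<Omega>" and r: "r \<in> \<Omega>" and x: "x \<in> \<Omega>"
  shows "noncoll z s (translation r x) = (noncoll z s r \<noteq> noncoll z s x)"
proof (cases "s = z")
  case False
  have rx: "translation r x \<in> \<Omega>" using A_points translation_in_A r x by blast
  have "noncoll r (translation r s) (translation r x) = noncoll z s x" using noncoll_tr[OF r, of z s x] translation_base[OF r] by simp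
  then show ?thesis
    using noncoll_tr_collinear[OF s False r, of "translation r x"] translation_product(2)[OF s r _ rx] by blast
qed simp

text \<open>The group laws are those of \<open>A\<close> evaluated at \<open>z\<close>;
  nondegeneracy says that no support is all of \<open>\<Omega>\<close>.\<close>

sublocale symplectic_space \<Omega> translation z "noncoll z"
proof
  show "finite \<Omega>" by (rule finite_points)
  show "z \<in> \<Omega>" by (rule base)
  show closed: "translation x y \<in> \<Omega>" if "x \<in> \<Omega>" "y \<in> \<Omega>" for x y
    using A_points translation_in_A that by blast
  show comm: "translation x y = translation y x" if "x \<in> \<Omega>" "y \<in> \<Omega>" for x y
  proof -
    have "(translation x \<circ> translation y) z = (translation y \<circ> translation x) z" using A_comm translation_in_A that by metis
    then show ?thesis using translation_base that by simp
  qed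
  show "translation (translation x y) w = translation x (translation y w)" if "x \<in> \<Omega>" "y \<in> \<Omega>" "w \<in> \<Omega>" for x y w
  proof -
    have "translation ((translation x \<circ> translation y) z) = translation x \<circ> translation y" using translation_eq A_comp translation_in_A that by blast
    then show ?thesis using translation_base that by simp
  qed
  show "translation z x = x" for x using translation_of_base by simp
  show "translation x x = z" if "x \<in> \<Omega>" for x
    using A_involution_apply[OF translation_in_A[OF that], of z] translation_base[OF that] by simp
  show "noncoll z x y = noncoll z y x" for x y by (rule noncoll_swap23)
  show "\<not> noncoll z x x" for x by simp
  show "noncoll z x (translation y w) = (noncoll z x y \<noteq> noncoll z x w)" if "x \<in> \<Omega>" "y \<in> \<Omega>" "w \<in> \<Omega>" for x y w
    using noncoll_additive that .
  show "\<exists>y\<in>\<Omega>. noncoll z x y" if "x \<in> \<Omega>" "x \<noteq> z" for x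
    using exists_outside_support[OF base that(1)] that(2) by metis
qed

section \<open>The stabilizer of the base point\<close>

lemma translation_conj:
  assumes g: "g \<in> moves_monoid" and x: "x \<in> \<Omega>"
  shows "\<exists>s\<in>A. g \<circ> translation x = s \<circ> g"
proof -
  have "g \<circ> translation x \<circ> perm_inv g \<circ> g = g \<circ> translation x"
    using moves_comp_inverse(2)[OF g] by (metis comp_assoc comp_id)
  then show ?thesis using A_conj[OF g translation_in_A[OF x]] by metis
qed

text \<open>For \<open>r\<close> with \<open>noncoll z u r\<close>, translation by \<open>u\<close>
  is the product of \<open>t z u\<close> and \<open>t r (translation r u)\<close>, whose supports
  are complementary. The second factor thus translates exactly the points that pair non-trivially
  with \<open>u\<close>.\<close>

lemma transvection_in_moves:
  assumes u: "u \<in> \<Omega>" shows "transvection u \<in> moves_monoid"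
proof (cases "u = z")
  case True
  then have "transvection u = id"
    by (auto simp: transvection_def fun_eq_iff noncoll_swap23[of z _ z])
  then show ?thesis using moves_id by metis
next
  case False
  then obtain r where r: "r \<in> \<Omega>" "noncoll z u r" using form_nondegenerate[OF u] by blast
  have ru: "translation r u \<in> \<Omega>" using add_closed r(1) u by blast
  have "transvection u = t r (translation r u)"
  proof
    fix x
    show "transvection u x = t r (translation r u) x"
    proof (cases "x \<in> \<Omega>")
      case False
      then show ?thesis using move_outside[OF r(1) ru False] by (simp add: transvection_def)
    next
      case x: True
      have alt: "noncoll r (translation r u) x \<noteq> noncoll z u x" using translation_product(2)[OF u r x] .
      show ?thesis
      proof (cases "noncoll z x u")
        case False
        then have "noncoll r (translation r u) x" using alt noncoll_swap23 by blast
        then show ?thesis using False move_fixes by (simp add: transvection_def)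
      next
        case True
        let ?y = "t r (translation r u) x"
        have y: "?y \<in> \<Omega>" using move_in_points r(1) ru x by blast
        have ux: "noncoll z u x" using True noncoll_swap23 by blast
        then have nx: "\<not> noncoll r (translation r u) x" using alt by blast
        have ne: "r \<noteq> translation r u"
          using automorphism_inj[OF A_automorphism[OF translation_in_A[OF r(1)]], of z u] translation_base[OF r(1)] False
            \<open>u \<noteq> z\<close> by metis
        have "\<not> noncoll r (translation r u) ?y" using nx move_fixed_iff[OF ne] move_involutive by metis
        \<comment> \<open>\<open>?y\<close> stays in the support of the second factor, hence is
          fixed by \<open>t z u\<close>.\<close>
        then have "noncoll z u ?y" using translation_product(2)[OF u r y] by blast
        then have "translation u x = ?y" using translation_product(1)[OF u r] move_fixes by simp
        then show ?thesis using True x add_comm[OF x u] by (simp add: transvection_def)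
      qed
    qed
  qed
  then show ?thesis using move_in_moves[OF r(1) ru] by simp
qed

text \<open>Normality of \<open>A\<close> makes a move product fixing \<open>z\<close> additive, and
  automorphisms preserve \<open>noncoll\<close>. Conversely, the stabilizer contains the
  transvections, which generate all isometries.\<close>

lemma stabilizer_eq_isometries: "{g \<in> moves_monoid. g z = z} = {g. isometry g}"
proof (intro equalityI subsetI)
  fix g assume "g \<in> {g \<in> moves_monoid. g z = z}"
  then have g: "g \<in> moves_monoid" "g z = z" by auto
  note aut = moves_automorphism[OF g(1)]
  show "g \<in> {g. isometry g}"
    unfolding isometry_def
  proof (intro CollectI conjI allI impI ballI)
    have "g ` \<Omega> \<subseteq> \<Omega>" using automorphism_points[OF aut] by blast
    moreover have "inj_on g \<Omega>" using automorphism_inj[OF aut] by (auto simp: inj_on_def)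
    ultimately show "bij_betw g \<Omega> \<Omega>"
      using endo_inj_surj[OF finite_points] unfolding bij_betw_def by blast
    show "g x = x" if "x \<notin> \<Omega>" for x using aut that unfolding automorphism_def by blast
    show "g (translation x y) = translation (g x) (g y)" if x: "x \<in> \<Omega>" for x y
    proof -
      obtain s where s: "s \<in> A" "g \<circ> translation x = s \<circ> g" using translation_conj[OF g(1) x] by blast
      have app: "g (translation x w) = s (g w)" for w using s(2) by (metis comp_apply)
      have "s z = g x" using app[of z] translation_base[OF x] g(2) by simp
      then show ?thesis using app translation_eq[OF s(1)] by simp
    qed
    show "noncoll z (g x) (g y) = noncoll z x y" for x y using automorphism_noncoll[OF aut, of z x y] g(2) by simp
  qed
next
  fix g assume "g \<in> {g. isometry g}"
  then have g: "isometry g" by simp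
  show "g \<in> {g \<in> moves_monoid. g z = z}"
  proof (rule transvections_generate[OF g])
    show "id \<in> {g \<in> moves_monoid. g z = z}" using moves_id by simp
    fix u h assume u: "u \<in> \<Omega>" and h: "h \<in> {g \<in> moves_monoid. g z = z}"
    have "transvection u z = z" by (simp add: transvection_def)
    then show "transvection u \<circ> h \<in> {g \<in> moves_monoid. g z = z}"
      using moves_comp[OF transvection_in_moves[OF u]] h by simp
  qed
qed

abbreviation G where "G \<equiv> L_inf \<Omega> B z"

lemma carrier_stabilizer: "carrier (point_stabilizer G z) = {g \<in> moves_monoid. g z = z}"
  using carrier_L_inf[OF base] by (simp add: point_stabilizer_def)

lemma mult_stabilizer: "g \<otimes>\<^bsub>point_stabilizer G z\<^esub> h = h \<circ> g"
  by (simp add: point_stabilizer_def)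

lemma inverse_fixes:
  assumes "g \<in> moves_monoid" "g z = z" shows "perm_inv g z = z"
  using moves_comp_inverse(2)[OF assms(1)] assms(2) by (metis comp_apply id_apply)

lemma group_stabilizer: "group (point_stabilizer G z)"
proof -
  interpret group G using group_L_inf[OF base] .
  have "subgroup {g \<in> carrier G. g z = z} G"
  proof (rule subgroupI)
    show "{g \<in> carrier G. g z = z} \<noteq> {}" using moves_id carrier_L_inf[OF base] by fastforce
    show "inv\<^bsub>G\<^esub> g \<in> {g \<in> carrier G. g z = z}" if "g \<in> {g \<in> carrier G. g z = z}" for g
      using that inverse_fixes inv_L_inf[OF base] moves_inverse carrier_L_inf[OF base] by auto
    show "g \<otimes>\<^bsub>G\<^esub> h \<in> {g \<in> carrier G. g z = z}"
      if "g \<in> {g \<in> carrier G. g z = z}" "h \<in> {g \<in> carrier G. g z = z}" for g h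
      using that moves_comp carrier_L_inf[OF base] by auto
  qed blast
  then show ?thesis unfolding point_stabilizer_def by (rule subgroup_imp_group)
qed

lemma perm_inv_comp:
  assumes "g \<in> moves_monoid" "h \<in> moves_monoid"
  shows "perm_inv (h \<circ> g) = perm_inv g \<circ> perm_inv h"
  using o_inv_distrib moves_bij assms by blast

text \<open>In \<open>G\<close> products are composed from left to right, in \<open>Sp2\<close> from right to left;
  inversion translates between the two.\<close>
lemma stabilizer_iso_Sp2:
  "\<exists>m. card \<Omega> = 2 ^ (2 * m) \<and> point_stabilizer G z \<cong> Sp2 m"
proof -
  obtain m \<Psi> where m: "card \<Omega> = 2 ^ (2 * m)"
    and bij: "bij_betw \<Psi> {g. isometry g} (carrier (Sp2 m))"
    and mult: "\<And>g g'. isometry g \<Longrightarrow> isometry g' \<Longrightarrow> \<Psi> (g \<circ> g') = \<Psi> g \<otimes>\<^bsub>Sp2 m\<^esub> \<Psi> g'"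
    using isometries_Sp2 by blast
  let ?S = "{g \<in> moves_monoid. g z = z}"
  have inv_S: "perm_inv g \<in> ?S" if "g \<in> ?S" for g
    using that moves_inverse inverse_fixes by blast
  have inv_inv: "perm_inv (perm_inv g) = g" if "g \<in> ?S" for g
    using that moves_bij inv_inv_eq by blast
  have "bij_betw perm_inv ?S ?S"
    by (rule bij_betw_byWitness[where f' = perm_inv]) (use inv_S inv_inv in blast)+
  then have b: "bij_betw (\<Psi> \<circ> perm_inv) ?S (carrier (Sp2 m))"
    using bij bij_betw_trans unfolding stabilizer_eq_isometries by blast
  have "(\<Psi> \<circ> perm_inv) \<in> iso (point_stabilizer G z) (Sp2 m)"
    unfolding iso_def hom_def carrier_stabilizer mult_stabilizer
  proof (intro CollectI conjI ballI Pi_I b)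
    show "(\<Psi> \<circ> perm_inv) g \<in> carrier (Sp2 m)" if "g \<in> ?S" for g using b that bij_betwE by blast
    fix g h assume gh: "g \<in> ?S" "h \<in> ?S"
    have "perm_inv (h \<circ> g) = perm_inv g \<circ> perm_inv h" using perm_inv_comp gh by blast
    moreover have "isometry (perm_inv g)" "isometry (perm_inv h)"
      using inv_S[OF gh(1)] inv_S[OF gh(2)] unfolding stabilizer_eq_isometries by auto
    ultimately show "(\<Psi> \<circ> perm_inv) (h \<circ> g) = (\<Psi> \<circ> perm_inv) g \<otimes>\<^bsub>Sp2 m\<^esub> (\<Psi> \<circ> perm_inv) h"
      using mult by (metis comp_apply)
  qed
  then show ?thesis using m unfolding is_iso_def by blast
qed

section \<open>The quotient by the translations\<close>

definition linear_part :: "('a \<Rightarrow> 'a) \<Rightarrow> 'a \<Rightarrow> 'a" where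
  "linear_part g = translation (g z) \<circ> g"

lemma moves_base: "g \<in> moves_monoid \<Longrightarrow> g z \<in> \<Omega>"
  using automorphism_points[OF moves_automorphism] base by blast

text \<open>Translations are involutions, so \<open>translation (g z)\<close> takes
  \<open>g z\<close> back to \<open>z\<close>.\<close>

lemma linear_part_stabilizer:
  assumes "g \<in> moves_monoid"
  shows "linear_part g \<in> {g \<in> moves_monoid. g z = z}"
proof -
  have "translation (g z) \<in> moves_monoid" using translation_in_A[OF moves_base[OF assms]] A_moves by blast
  then show ?thesis
    using moves_comp assms add_self[OF moves_base[OF assms]] unfolding linear_part_def by simp
qed

text \<open>Both sides fix \<open>z\<close> and arise from \<open>h \<circ> g\<close> by a left
  factor in \<open>A\<close>; regularity makes the two factors equal.\<close>

lemma linear_part_comp: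
  assumes g: "g \<in> moves_monoid" and h: "h \<in> moves_monoid"
  shows "linear_part (h \<circ> g) = linear_part h \<circ> linear_part g"
proof -
  have hg: "h \<circ> g \<in> moves_monoid" using moves_comp g h by blast
  obtain s where s: "s \<in> A" "h \<circ> translation (g z) = s \<circ> h" using translation_conj[OF h moves_base[OF g]] by blast
  have "linear_part h \<circ> linear_part g = translation (h z) \<circ> (h \<circ> translation (g z)) \<circ> g"
    unfolding linear_part_def by (simp only: comp_assoc)
  then have eq: "linear_part h \<circ> linear_part g = (translation (h z) \<circ> s) \<circ> (h \<circ> g)"
    unfolding s(2) by (simp only: comp_assoc)
  have a: "translation (h z) \<circ> s \<in> A" using A_comp translation_in_A moves_base[OF h] s(1) by blast
  have "(linear_part h \<circ> linear_part g) z = z"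
    using linear_part_stabilizer[OF g] linear_part_stabilizer[OF h] by simp
  then have "(translation (h z) \<circ> s) ((h \<circ> g) z) = z" unfolding eq by (metis comp_apply)
  moreover have "translation ((h \<circ> g) z) ((h \<circ> g) z) = z" using add_self[OF moves_base[OF hg]] .
  ultimately have "translation (h z) \<circ> s = translation ((h \<circ> g) z)"
    using A_unique[OF a translation_in_A[OF moves_base[OF hg]] moves_base[OF hg]] by metis
  then show ?thesis using eq unfolding linear_part_def by metis
qed

lemma linear_part_eq_id:
  assumes g: "g \<in> moves_monoid" shows "linear_part g = id \<longleftrightarrow> g \<in> A"
proof
  assume id: "linear_part g = id"
  have "translation (g z) \<circ> (translation (g z) \<circ> g) = translation (g z)" using id unfolding linear_part_def by (metis comp_id)
  then have "g = translation (g z)"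
    using A_involution[OF translation_in_A[OF moves_base[OF g]]] by (metis comp_assoc id_comp)
  then show "g \<in> A" using translation_in_A[OF moves_base[OF g]] by metis
next
  assume "g \<in> A"
  then show "linear_part g = id" using translation_eq A_involution unfolding linear_part_def by metis
qed

text \<open>First isomorphism theorem: \<open>linear_part\<close> has kernel \<open>A\<close> and is
  the identity on the stabilizer, hence onto it.\<close>

lemma quotient_iso_stabilizer: "G Mod A \<cong> point_stabilizer G z"
proof -
  interpret G: group G using group_L_inf[OF base] .
  interpret S: group "point_stabilizer G z" by (rule group_stabilizer)
  interpret group_hom G "point_stabilizer G z" linear_part
  proof
    show "linear_part \<in> hom G (point_stabilizer G z)"
      unfolding hom_def carrier_stabilizer carrier_L_inf[OF base] mult_stabilizer mult_L_inf
      using linear_part_stabilizer linear_part_comp by blast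
  qed
  have one: "\<one>\<^bsub>point_stabilizer G z\<^esub> = id" by (simp add: point_stabilizer_def)
  have "kernel G (point_stabilizer G z) linear_part = A"
    unfolding kernel_def carrier_L_inf[OF base] one using linear_part_eq_id A_moves by blast
  moreover have "linear_part g = g" if "g z = z" for g
    unfolding linear_part_def using translation_of_base that by (metis id_comp)
  then have "linear_part ` carrier G = carrier (point_stabilizer G z)"
    unfolding carrier_stabilizer carrier_L_inf[OF base]
    using linear_part_stabilizer by (auto simp: image_iff) metis
  ultimately show ?thesis using FactGroup_iso by metis
qed

end

text \<open>The last non-trivial term of the derived series of \<open>K\<close>.\<close>
lemma (in group) solvable_normal_imp_abelian_normal:
  assumes "K \<lhd> G" "K \<noteq> {\<one>}" "solvable (G\<lparr>carrier := K\<rparr>)"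
  shows "\<exists>A. A \<lhd> G \<and> A \<noteq> {\<one>} \<and> (\<forall>x\<in>A. \<forall>y\<in>A. x \<otimes> y = y \<otimes> x)"
proof -
  have K: "subgroup K G" using assms(1) normal_imp_subgroup by blast
  interpret GK: group "G\<lparr>carrier := K\<rparr>" using subgroup_imp_group[OF K] .
  have D: "(derived (G\<lparr>carrier := K\<rparr>) ^^ i) K = (derived G ^^ i) K \<and> (derived G ^^ i) K \<subseteq> K" for i
  proof (induction i)
    case (Suc i)
    then have "(derived G ^^ i) K \<subseteq> K" by blast
    then show ?case using Suc derived_consistent[OF _ K] derived_incl[OF _ K] by simp
  qed simp
  obtain i where "(derived G ^^ i) K = {\<one>}"
    using GK.solvable_iff_trivial_derived_seq assms(3) D by auto
  moreover have "(derived G ^^ 0) K \<noteq> {\<one>}" using assms(2) by simp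
  ultimately have "\<exists>j<i. (\<forall>l\<le>j. (derived G ^^ l) K \<noteq> {\<one>}) \<and> (derived G ^^ Suc j) K = {\<one>}"
    by (rule ex_least_nat_less)
  then obtain j where j: "(derived G ^^ j) K \<noteq> {\<one>}" "(derived G ^^ Suc j) K = {\<one>}" by blast
  let ?A = "(derived G ^^ j) K"
  have normal: "(derived G ^^ i) K \<lhd> G" for i
    by (induction i) (simp_all add: assms(1) derived_is_normal)
  have "x \<otimes> y = y \<otimes> x" if xy: "x \<in> ?A" "y \<in> ?A" for x y
  proof -
    have c: "x \<in> carrier G" "y \<in> carrier G"
      using xy subgroup.subset[OF normal_imp_subgroup[OF normal]] by blast+
    \<comment> \<open>Commutators of elements of \<open>?A\<close> lie in the next derived term,
      which is trivial.\<close>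
    have "x \<otimes> y \<otimes> inv x \<otimes> inv y \<in> derived_set G ?A" using xy by blast
    then have "x \<otimes> y \<otimes> inv x \<otimes> inv y \<in> derived G ?A" unfolding derived_def by (rule generate.incl)
    then have "x \<otimes> y \<otimes> inv x \<otimes> inv y = \<one>" using j(2) by simp
    then have "x \<otimes> y \<otimes> inv (y \<otimes> x) = \<one>" using c by (simp add: inv_mult_group m_assoc)
    then show ?thesis using c inv_equality[of "x \<otimes> y" "inv (y \<otimes> x)"] by (metis inv_closed inv_inv m_closed)
  qed
  then show ?thesis using normal[of j] j(1) by blast
qed

theorem corollary5p18:
  fixes \<Omega> :: "'a set" and B :: "'a set multiset" and n lam :: nat and oo :: 'a
  assumes "design_2_4 \<Omega> B n lam"
    and "supersimple B"
    and "property_triangle B"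
    and "regular_two_graph \<Omega> (collinear_triples \<Omega> B)"
    and "n > 2 * lam + 2"
    and "oo \<in> \<Omega>"
    and "\<exists>N. N \<lhd> L_inf \<Omega> B oo \<and> N \<noteq> {\<one>\<^bsub>L_inf \<Omega> B oo\<^esub>} \<and>
              solvable ((L_inf \<Omega> B oo)\<lparr>carrier := N\<rparr>)"
  shows "\<exists>m::nat. m \<ge> 2 \<and> is_2_2m_Sp (L_inf \<Omega> B oo) m \<and> n = 2 ^ (2*m) \<and>
           (\<forall>x \<in> \<Omega>. point_stabilizer (L_inf \<Omega> B oo) x \<cong> Sp2 m)"
proof -
  interpret triangle_design \<Omega> B n lam using assms(1-5) by unfold_locales
  let ?G = "L_inf \<Omega> B oo"
  note carrier = carrier_L_inf[OF assms(6)]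
  interpret G: group ?G using group_L_inf[OF assms(6)] .
  obtain A where A: "A \<lhd> ?G" "A \<noteq> {id}" "\<And>r s. r \<in> A \<Longrightarrow> s \<in> A \<Longrightarrow> s \<circ> r = r \<circ> s"
    using G.solvable_normal_imp_abelian_normal assms(7) unfolding one_L_inf mult_L_inf by blast
  have sub: "subgroup A ?G" using normal_imp_subgroup[OF A(1)] .
  have AM: "A \<subseteq> moves_monoid" using subgroup.subset[OF sub] carrier by simp
  interpret D: design_abelian_normal \<Omega> B n lam A
  proof
    show "A \<subseteq> moves_monoid" by (rule AM)
    show "id \<in> A" using subgroup.one_closed[OF sub] unfolding one_L_inf .
    show "s \<circ> r \<in> A" if "s \<in> A" "r \<in> A" for s r
      using subgroup.m_closed[OF sub that(2,1)] unfolding mult_L_inf .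
    show "perm_inv s \<in> A" if "s \<in> A" for s
      using subgroup.m_inv_closed[OF sub that] inv_L_inf[OF assms(6)] AM that by auto
    show "g \<circ> s \<circ> perm_inv g \<in> A" if g: "g \<in> moves_monoid" and s: "s \<in> A" for g s
    proof -
      \<comment> \<open>The group product is reversed, so conjugation of functions by
        \<open>g\<close> is conjugation by the inverse in the group.\<close>
      have "inv\<^bsub>?G\<^esub> g \<otimes>\<^bsub>?G\<^esub> s \<otimes>\<^bsub>?G\<^esub> g \<in> A" using normal.inv_op_closed1[OF A(1) _ s] g carrier by blast
      then show ?thesis unfolding mult_L_inf inv_L_inf[OF assms(6) g] by (simp only: comp_assoc)
    qed
    show "s \<circ> r = r \<circ> s" if "s \<in> A" "r \<in> A" for s r using A(3) that by blast
    show "A \<noteq> {id}" by (rule A(2))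
  qed
  have affine: "affine_design \<Omega> B n lam A x" if "x \<in> \<Omega>" for x
    using that by unfold_locales
  have n: "card \<Omega> = n" using assms(1) by (simp add: design_2_4_def)
  obtain m where m: "n = 2 ^ (2 * m)" "point_stabilizer ?G oo \<cong> Sp2 m"
    using affine_design.stabilizer_iso_Sp2[OF affine[OF assms(6)]] n by metis
  have "point_stabilizer ?G x \<cong> Sp2 m" if x: "x \<in> \<Omega>" for x
  proof -
    obtain k where k: "card \<Omega> = 2 ^ (2 * k)" "point_stabilizer (L_inf \<Omega> B x) x \<cong> Sp2 k"
      using affine_design.stabilizer_iso_Sp2[OF affine[OF x]] by blast
    \<comment> \<open>The rank is the same at every point because \<open>card \<Omega>\<close>
      determines it.\<close>
    have "(2::nat) ^ (2 * k) = 2 ^ (2 * m)" using k(1) m(1) n by metis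
    then have "k = m" by (simp add: power_inject_exp)
    then show ?thesis using k(2) L_inf_eq[OF x assms(6)] by metis
  qed
  \<comment> \<open>As \<open>lam \<ge> 1\<close>, there are more than four points.\<close>
  moreover have "m \<ge> 2"
  proof (rule ccontr)
    assume "\<not> m \<ge> 2"
    then have "n \<le> 2 ^ 2" unfolding m(1) by (intro power_increasing) auto
    then show False using assms(1,5) by (simp add: design_2_4_def)
  qed
  moreover have "elem_abelian_2_subgroup ?G A (2 * m)"
    unfolding elem_abelian_2_subgroup_def
  proof (intro conjI ballI)
    show "subgroup A ?G" by (rule sub)
    show "comm_group (?G\<lparr>carrier := A\<rparr>)"
      by (rule group.group_comm_groupI[OF G.subgroup_imp_group[OF sub]]) (use A(3) in simp)
    show "s \<otimes>\<^bsub>?G\<^esub> s = \<one>\<^bsub>?G\<^esub>" if "s \<in> A" for s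
      using D.A_involution[OF that] unfolding mult_L_inf one_L_inf .
    note b = D.A_bij_betw_points[OF assms(6)]
    show "finite A" using b finite_points bij_betw_finite by blast
    show "card A = 2 ^ (2 * m)" using bij_betw_same_card[OF b] n m(1) by simp
  qed
  moreover have "?G Mod A \<cong> Sp2 m"
    using affine_design.quotient_iso_stabilizer[OF affine[OF assms(6)]] m(2) iso_trans by blast
  ultimately show ?thesis using m(1) A(1) unfolding is_2_2m_Sp_def by blast
qed

end
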